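(* Let $\theta\colon S\rightarrow R$ be a $P$-$W$-reflexive extension for an invertible $S$-bimodule $P$ and an invertible $R$-bimodule $W$. Then a left $R$-module $X$ is reflexive (resp. torsionless) as an $R$-module if and only if the underlying left $S$-module $X$ (with $S$ acting via $\theta$) is reflexive (resp. torsionless) as an $S$-module.
   Context: Rings are associative with unit, and ring homomorphisms preserve the unit. Right $S$-modules are identified with left $S^{\rm op}$-modules; ${\rm Hom}_S$ denotes left $S$-homomorphisms and ${\rm Hom}_{S^{\rm op}}$ denotes right $S$-homomorphisms. A ring extension is a ring homomorphism $\theta\colon S\rightarrow R$. Via $\theta$, $R$ is an $S$-bimodule (also an $R$-$S$-bimodule and an $S$-$R$-bimodule), and $R$-modules and $R$-bimodules acquire underlying $S$-structures. If $X$ is an $S$-$R$-bimodule and $Y$ an $S$-$T$-bimodule, then ${\rm Hom}_S(X,Y)$ is an $R$-$T$-bimodule via $(r.f.t)(x)=f(x.r).t$. An $S$-bimodule $P$ is invertible if the endofunctor ${\rm Hom}_S(P,-)$ of the category of left $S$-modules is an equivalence; similarly for $R$-bimodules. A left $S$-module $X$ is reflexive (resp. torsionless) if the evaluation map ${\rm ev}_X\colon X\rightarrow {\rm Hom}_{S^{\rm op}}({\rm Hom}_S(X,S),S)$, ${\rm ev}_X(x)(f)=f(x)$, is an isomorphism (resp. a monomorphism); similarly for $R$-modules. For an invertible $S$-bimodule $P$ and an invertible $R$-bimodule $W$, the ring extension $\theta$ is $P$-$W$-reflexive if the left $S$-module ${}_SR$ is reflexive and there is an isomorphism ${\rm Hom}_S(R,P)\simeq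 W$ of $R$-$S$-bimodules. *)

theory Defs
  imports "HOL-Algebra.RingHom" "HOL-Algebra.Module" "HOL-Library.FuncSet"
begin

section \<open>Modules and bimodules over noncommutative rings\<close>

text \<open>The locale \<open>module\<close> of HOL-Algebra requires a commutative ring. We keep its record type,
  whose fields \<open>mult\<close> and \<open>one\<close> play no role for modules.\<close>

locale left_module = R?: ring R + M?: abelian_group M for R (structure) and M (structure) +
  assumes smult_closed: "\<lbrakk>a \<in> carrier R; x \<in> carrier M\<rbrakk> \<Longrightarrow> a \<odot>\<^bsub>M\<^esub> x \<in> carrier M"
    and smult_l_distr: "\<lbrakk>a \<in> carrier R; b \<in> carrier R; x \<in> carrier M\<rbrakk> \<Longrightarrow>
      (a \<oplus> b) \<odot>\<^bsub>M\<^esub> x = a \<odot>\<^bsub>M\<^esub> x \<oplus>\<^bsub>M\<^esub> b \<odot>\<^bsub>M\<^esub> x"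
    and smult_r_distr: "\<lbrakk>a \<in> carrier R; x \<in> carrier M; y \<in> carrier M\<rbrakk> \<Longrightarrow>
      a \<odot>\<^bsub>M\<^esub> (x \<oplus>\<^bsub>M\<^esub> y) = a \<odot>\<^bsub>M\<^esub> x \<oplus>\<^bsub>M\<^esub> a \<odot>\<^bsub>M\<^esub> y"
    and smult_assoc: "\<lbrakk>a \<in> carrier R; b \<in> carrier R; x \<in> carrier M\<rbrakk> \<Longrightarrow>
      (a \<otimes> b) \<odot>\<^bsub>M\<^esub> x = a \<odot>\<^bsub>M\<^esub> (b \<odot>\<^bsub>M\<^esub> x)"
    and smult_one: "x \<in> carrier M \<Longrightarrow> \<one> \<odot>\<^bsub>M\<^esub> x = x"

text \<open>Right \<open>S\<close>-modules are left modules over the opposite ring. Accordingly every right action is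
  written with the scalar first: \<open>rsmult B r x\<close> stands for \<open>x.r\<close>.\<close>

definition opposite_ring :: "('a, 'm) ring_scheme \<Rightarrow> ('a, 'm) ring_scheme" where
  "opposite_ring S = S\<lparr>mult := (\<lambda>a b. b \<otimes>\<^bsub>S\<^esub> a)\<rparr>"

record ('s, 'r, 'b) bimodule = "('s, 'b) module" +
  rsmult :: "'r \<Rightarrow> 'b \<Rightarrow> 'b"

definition with_action :: "('b, 'm) ring_scheme \<Rightarrow> ('s \<Rightarrow> 'b \<Rightarrow> 'b) \<Rightarrow> ('s, 'b) module" where
  "with_action A l = \<lparr>carrier = carrier A, mult = mult A, one = one A, zero = zero A, add = add A,
     smult = l\<rparr>"

definition with_biaction ::
    "('b, 'm) ring_scheme \<Rightarrow> ('s \<Rightarrow> 'b \<Rightarrow> 'b) \<Rightarrow> ('r \<Rightarrow> 'b \<Rightarrow> 'b) \<Rightarrow> ('s, 'r, 'b) bimodule" where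
  "with_biaction A l r = \<lparr>carrier = carrier A, mult = mult A, one = one A, zero = zero A,
     add = add A, smult = l, rsmult = r\<rparr>"

definition right_part :: "('s, 'r, 'b) bimodule \<Rightarrow> ('r, 'b) module" where
  "right_part B = with_action B (rsmult B)"

definition bimodule ::
    "('s, 'm) ring_scheme \<Rightarrow> ('r, 'n) ring_scheme \<Rightarrow> ('s, 'r, 'b) bimodule \<Rightarrow> bool" where
  "bimodule S R B \<longleftrightarrow> left_module S B \<and> left_module (opposite_ring R) (right_part B) \<and>
     (\<forall>s\<in>carrier S. \<forall>r\<in>carrier R. \<forall>x\<in>carrier B.
        rsmult B r (smult B s x) = smult B s (rsmult B r x))"

definition regular_module :: "('s, 'm) ring_scheme \<Rightarrow> ('s, 's) module" where
  "regular_module S = with_action S (mult S)"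

definition restrict_scalars :: "('s \<Rightarrow> 'r) \<Rightarrow> ('r, 'x, 'm) module_scheme \<Rightarrow> ('s, 'x) module" where
  "restrict_scalars \<theta> X = with_action X (\<lambda>s. smult X (\<theta> s))"


section \<open>Homomorphisms\<close>

text \<open>Homomorphisms are extensional functions, so that equality of homomorphisms is equality on
  the carrier of the domain.\<close>

definition lin_hom ::
    "('s, 'k) ring_scheme \<Rightarrow> ('s, 'x, 'm) module_scheme \<Rightarrow> ('s, 'y, 'n) module_scheme \<Rightarrow> ('x \<Rightarrow> 'y) set"
  where
  "lin_hom S X Y = {f \<in> carrier X \<rightarrow>\<^sub>E carrier Y.
     (\<forall>x\<in>carrier X. \<forall>y\<in>carrier X. f (x \<oplus>\<^bsub>X\<^esub> y) = f x \<oplus>\<^bsub>Y\<^esub> f y) \<and>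
     (\<forall>s\<in>carrier S. \<forall>x\<in>carrier X. f (s \<odot>\<^bsub>X\<^esub> x) = s \<odot>\<^bsub>Y\<^esub> f x)}"

definition module_iso ::
    "('s, 'k) ring_scheme \<Rightarrow> ('s, 'x, 'm) module_scheme \<Rightarrow> ('s, 'y, 'n) module_scheme \<Rightarrow> ('x \<Rightarrow> 'y) set"
  where
  "module_iso S X Y = {f \<in> lin_hom S X Y. bij_betw f (carrier X) (carrier Y)}"

definition module_mono ::
    "('s, 'k) ring_scheme \<Rightarrow> ('s, 'x, 'm) module_scheme \<Rightarrow> ('s, 'y, 'n) module_scheme \<Rightarrow> ('x \<Rightarrow> 'y) set"
  where
  "module_mono S X Y = {f \<in> lin_hom S X Y. inj_on f (carrier X)}"

definition bimodule_iso ::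
    "('s, 'k) ring_scheme \<Rightarrow> ('r, 'l) ring_scheme \<Rightarrow> ('s, 'r, 'x) bimodule \<Rightarrow> ('s, 'r, 'y) bimodule
       \<Rightarrow> ('x \<Rightarrow> 'y) set" where
  "bimodule_iso S R X Y =
     module_iso S X Y \<inter> module_iso (opposite_ring R) (right_part X) (right_part Y)"

definition hom_group ::
    "('s, 'k) ring_scheme \<Rightarrow> ('s, 'x, 'm) module_scheme \<Rightarrow> ('s, 'y, 'n) module_scheme
       \<Rightarrow> ('x \<Rightarrow> 'y) ring" where
  "hom_group S X Y = \<lparr>carrier = lin_hom S X Y, mult = undefined, one = undefined,
     zero = (\<lambda>x\<in>carrier X. \<zero>\<^bsub>Y\<^esub>), add = (\<lambda>f g. \<lambda>x\<in>carrier X. f x \<oplus>\<^bsub>Y\<^esub> g x)\<rparr>"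

text \<open>For an \<open>S\<close>-\<open>R\<close>-bimodule \<open>X\<close> and a left \<open>S\<close>-module \<open>Y\<close>: the left \<open>R\<close>-module \<open>Hom\<^sub>S(X,Y)\<close>
  with \<open>(r.f)(x) = f(x.r)\<close>.\<close>

definition hom_left ::
    "('s, 'k) ring_scheme \<Rightarrow> ('s, 'r, 'x) bimodule \<Rightarrow> ('s, 'y, 'n) module_scheme
       \<Rightarrow> ('r, 'x \<Rightarrow> 'y) module" where
  "hom_left S X Y = with_action (hom_group S X Y) (\<lambda>r f. \<lambda>x\<in>carrier X. f (rsmult X r x))"

text \<open>For an \<open>S\<close>-\<open>R\<close>-bimodule \<open>X\<close> and an \<open>S\<close>-\<open>T\<close>-bimodule \<open>Y\<close>: the \<open>R\<close>-\<open>T\<close>-bimodule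
  \<open>Hom\<^sub>S(X,Y)\<close> with \<open>(r.f.t)(x) = f(x.r).t\<close>.\<close>

definition hom_bimodule ::
    "('s, 'k) ring_scheme \<Rightarrow> ('s, 'r, 'x) bimodule \<Rightarrow> ('s, 't, 'y) bimodule
       \<Rightarrow> ('r, 't, 'x \<Rightarrow> 'y) bimodule" where
  "hom_bimodule S X Y = with_biaction (hom_group S X Y)
     (\<lambda>r f. \<lambda>x\<in>carrier X. f (rsmult X r x)) (\<lambda>t f. \<lambda>x\<in>carrier X. rsmult Y t (f x))"


section \<open>Reflexive and torsionless modules\<close>

text \<open>The right \<open>S\<close>-module \<open>Hom\<^sub>S(X,S)\<close> with \<open>(f.s)(x) = f(x)s\<close>, as a left module over the opposite
  ring. Since the opposite of the opposite ring is \<open>S\<close>, the bidual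
  \<open>Hom\<^bsub>S\<^sup>o\<^sup>p\<^esub>(Hom\<^sub>S(X,S),S)\<close> is the same construction over the opposite ring.\<close>

definition dual ::
    "('s, 'k) ring_scheme \<Rightarrow> ('s, 'x, 'm) module_scheme \<Rightarrow> ('s, 'x \<Rightarrow> 's) module" where
  "dual S X = with_action (hom_group S X (regular_module S))
     (\<lambda>s f. \<lambda>x\<in>carrier X. f x \<otimes>\<^bsub>S\<^esub> s)"

definition bidual ::
    "('s, 'k) ring_scheme \<Rightarrow> ('s, 'x, 'm) module_scheme \<Rightarrow> ('s, ('x \<Rightarrow> 's) \<Rightarrow> 's) module" where
  "bidual S X = dual (opposite_ring S) (dual S X)"

definition ev ::
    "('s, 'k) ring_scheme \<Rightarrow> ('s, 'x, 'm) module_scheme \<Rightarrow> 'x \<Rightarrow> ('x \<Rightarrow> 's) \<Rightarrow> 's" where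
  "ev S X = (\<lambda>x\<in>carrier X. \<lambda>f\<in>carrier (dual S X). f x)"

definition reflexive_module :: "('s, 'k) ring_scheme \<Rightarrow> ('s, 'x, 'm) module_scheme \<Rightarrow> bool" where
  "reflexive_module S X \<longleftrightarrow> ev S X \<in> module_iso S X (bidual S X)"

definition torsionless_module :: "('s, 'k) ring_scheme \<Rightarrow> ('s, 'x, 'm) module_scheme \<Rightarrow> bool" where
  "torsionless_module S X \<longleftrightarrow> ev S X \<in> module_mono S X (bidual S X)"


section \<open>Equivalences of categories\<close>

record ('o, 'm) cat =
  obj :: "'o set"
  arr :: "'o \<Rightarrow> 'o \<Rightarrow> 'm set"
  ident :: "'o \<Rightarrow> 'm"
  comp :: "'o \<Rightarrow> 'o \<Rightarrow> 'o \<Rightarrow> 'm \<Rightarrow> 'm \<Rightarrow> 'm"  \<comment> \<open>\<open>comp C X Y Z g f = g \<circ> f\<close> for \<open>f: X \<rightarrow> Y\<close>, \<open>g: Y \<rightarrow> Z\<close>\<close>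

record ('o, 'm, 'p, 'n) cat_functor =
  on_obj :: "'o \<Rightarrow> 'p"
  on_arr :: "'o \<Rightarrow> 'o \<Rightarrow> 'm \<Rightarrow> 'n"

definition is_functor :: "('o, 'm) cat \<Rightarrow> ('p, 'n) cat \<Rightarrow> ('o, 'm, 'p, 'n) cat_functor \<Rightarrow> bool" where
  "is_functor C D F \<longleftrightarrow>
     (\<forall>X\<in>obj C. on_obj F X \<in> obj D) \<and>
     (\<forall>X\<in>obj C. \<forall>Y\<in>obj C. \<forall>f\<in>arr C X Y. on_arr F X Y f \<in> arr D (on_obj F X) (on_obj F Y)) \<and>
     (\<forall>X\<in>obj C. on_arr F X X (ident C X) = ident D (on_obj F X)) \<and>
     (\<forall>X\<in>obj C. \<forall>Y\<in>obj C. \<forall>Z\<in>obj C. \<forall>f\<in>arr C X Y. \<forall>g\<in>arr C Y Z.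
        on_arr F X Z (comp C X Y Z g f) =
        comp D (on_obj F X) (on_obj F Y) (on_obj F Z) (on_arr F Y Z g) (on_arr F X Y f))"

definition id_functor :: "('o, 'm, 'o, 'm) cat_functor" where
  "id_functor = \<lparr>on_obj = (\<lambda>X. X), on_arr = (\<lambda>X Y f. f)\<rparr>"

definition comp_functor ::
    "('p, 'n, 'q, 'l) cat_functor \<Rightarrow> ('o, 'm, 'p, 'n) cat_functor \<Rightarrow> ('o, 'm, 'q, 'l) cat_functor" where
  "comp_functor G F = \<lparr>on_obj = (\<lambda>X. on_obj G (on_obj F X)),
     on_arr = (\<lambda>X Y f. on_arr G (on_obj F X) (on_obj F Y) (on_arr F X Y f))\<rparr>"

definition is_iso :: "('o, 'm) cat \<Rightarrow> 'o \<Rightarrow> 'o \<Rightarrow> 'm \<Rightarrow> bool" where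
  "is_iso C X Y f \<longleftrightarrow> f \<in> arr C X Y \<and>
     (\<exists>g\<in>arr C Y X. comp C X Y X g f = ident C X \<and> comp C Y X Y f g = ident C Y)"

definition naturally_isomorphic ::
    "('o, 'm) cat \<Rightarrow> ('p, 'n) cat \<Rightarrow> ('o, 'm, 'p, 'n) cat_functor \<Rightarrow> ('o, 'm, 'p, 'n) cat_functor \<Rightarrow> bool"
  where
  "naturally_isomorphic C D F G \<longleftrightarrow> (\<exists>\<eta>.
     (\<forall>X\<in>obj C. is_iso D (on_obj F X) (on_obj G X) (\<eta> X)) \<and>
     (\<forall>X\<in>obj C. \<forall>Y\<in>obj C. \<forall>f\<in>arr C X Y.
        comp D (on_obj F X) (on_obj F Y) (on_obj G Y) (\<eta> Y) (on_arr F X Y f) =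
        comp D (on_obj F X) (on_obj G X) (on_obj G Y) (on_arr G X Y f) (\<eta> X)))"

definition is_equivalence :: "('o, 'm) cat \<Rightarrow> ('p, 'n) cat \<Rightarrow> ('o, 'm, 'p, 'n) cat_functor \<Rightarrow> bool" where
  "is_equivalence C D F \<longleftrightarrow> is_functor C D F \<and> (\<exists>G. is_functor D C G \<and>
     naturally_isomorphic C C id_functor (comp_functor G F) \<and>
     naturally_isomorphic D D (comp_functor F G) id_functor)"


section \<open>Invertible bimodules\<close>

text \<open>The category of left \<open>S\<close>-modules whose carrier is a subset of the type \<open>'u\<close>.\<close>

definition module_cat :: "('s, 'k) ring_scheme \<Rightarrow> (('s, 'u) module, 'u \<Rightarrow> 'u) cat" where
  "module_cat S = \<lparr>obj = {M. left_module S M}, arr = lin_hom S, ident = (\<lambda>M. \<lambda>x\<in>carrier M. x),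
     comp = (\<lambda>K L M g f. compose (carrier K) g f)\<rparr>"

definition hom_functor ::
    "('s, 'k) ring_scheme \<Rightarrow> ('s, 's, 'p) bimodule
       \<Rightarrow> (('s, 'u) module, 'u \<Rightarrow> 'u, ('s, 'p \<Rightarrow> 'u) module, ('p \<Rightarrow> 'u) \<Rightarrow> ('p \<Rightarrow> 'u)) cat_functor" where
  "hom_functor S P = \<lparr>on_obj = hom_left S P,
     on_arr = (\<lambda>M N f. \<lambda>h\<in>lin_hom S P M. compose (carrier P) f h)\<rparr>"

text \<open>HOL has no type of all sets, so the category of all left \<open>S\<close>-modules is represented by the
  modules inside a universe type \<open>'u\<close>. For a bimodule on \<open>'p\<close>, the functor \<open>Hom\<^sub>S(P,-)\<close> leads
  from modules in \<open>'u\<close> to modules in \<open>'p \<Rightarrow> 'u\<close>. The universe below contains copies of the ring,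
  of the bimodule and of an arbitrary further type \<open>'k\<close> (which makes it as large as desired), and
  it is in bijection with \<open>'p \<Rightarrow> 'u\<close>; hence both module categories are copies of one another and
  \<open>Hom\<^sub>S(P,-)\<close> is an endofunctor up to renaming of elements.\<close>

type_synonym ('s, 'p, 'k) universe = "('s + 'p + 'k) list set"

lemma universe_function_space:
  "\<exists>h :: ('p \<Rightarrow> ('s, 'p, 'k) universe) \<Rightarrow> ('s, 'p, 'k) universe. bij h"
proof -
  let ?e = "\<lambda>f :: 'p \<Rightarrow> ('s, 'p, 'k) universe. {Inr (Inl p) # w |p w. w \<in> f p}"
  have e: "inj ?e"
  proof (rule injI)
    fix f g :: "'p \<Rightarrow> ('s, 'p, 'k) universe"
    assume eq: "?e f = ?e g"
    have "w \<in> f p \<longleftrightarrow> w \<in> g p" for p w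
    proof -
      have "w \<in> f p \<longleftrightarrow> Inr (Inl p) # w \<in> ?e f" by auto
      also have "\<dots> \<longleftrightarrow> Inr (Inl p) # w \<in> ?e g" using eq by simp
      also have "\<dots> \<longleftrightarrow> w \<in> g p" by auto
      finally show ?thesis .
    qed
    then show "f = g" by blast
  qed
  have c: "inj (\<lambda>(u :: ('s, 'p, 'k) universe) (p :: 'p). u)"
    by (rule injI) (metis)
  show ?thesis
    using Schroeder_Bernstein[OF e _ c] by auto
qed

definition invertible_bimodule ::
    "'k itself \<Rightarrow> ('s, 'm) ring_scheme \<Rightarrow> ('s, 's, 'p) bimodule \<Rightarrow> bool" where
  "invertible_bimodule _ S P \<longleftrightarrow> bimodule S S P \<and>
     is_equivalence (module_cat S :: (('s, ('s, 'p, 'k) universe) module, _) cat) (module_cat S)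
       (hom_functor S P)"


section \<open>\<open>P\<close>-\<open>W\<close>-reflexive ring extensions\<close>

text \<open>For a ring extension \<open>\<theta>: S \<rightarrow> R\<close>: the \<open>S\<close>-\<open>R\<close>-bimodule \<open>R\<close>, and the \<open>R\<close>-\<open>S\<close>-bimodule
  underlying an \<open>R\<close>-bimodule.\<close>

definition extension_bimodule :: "('r, 'n) ring_scheme \<Rightarrow> ('s \<Rightarrow> 'r) \<Rightarrow> ('s, 'r, 'r) bimodule" where
  "extension_bimodule R \<theta> = with_biaction R (\<lambda>s x. \<theta> s \<otimes>\<^bsub>R\<^esub> x) (\<lambda>r x. x \<otimes>\<^bsub>R\<^esub> r)"

definition restrict_right :: "('s \<Rightarrow> 'r) \<Rightarrow> ('r, 'r, 'w) bimodule \<Rightarrow> ('r, 's, 'w) bimodule" where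
  "restrict_right \<theta> W = with_biaction W (smult W) (\<lambda>s. rsmult W (\<theta> s))"

definition PW_reflexive ::
    "('s, 'm) ring_scheme \<Rightarrow> ('r, 'n) ring_scheme \<Rightarrow> ('s \<Rightarrow> 'r)
       \<Rightarrow> ('s, 's, 'p) bimodule \<Rightarrow> ('r, 'r, 'w) bimodule \<Rightarrow> bool" where
  "PW_reflexive S R \<theta> P W \<longleftrightarrow>
     reflexive_module S (restrict_scalars \<theta> (regular_module R)) \<and>
     bimodule_iso R S (hom_bimodule S (extension_bimodule R \<theta>) P) (restrict_right \<theta> W) \<noteq> {}"

end

theory Submission
  imports Defs
begin

text \<open>
  The idea is to replace the ground rings as values of linear functionals by the invertible
  bimodules. If \<open>Hom\<^sub>S(P,-)\<close> is an equivalence, then \<open>P\<close> is a finitely generated projective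
  generator on the left, and its left endomorphisms are exactly the right multiplications by
  elements of \<open>S\<close> (\<open>invertible_progenerator\<close>). The modules \<open>S\<close> and \<open>P\<close> are then direct summands of
  finite powers of one another, and therefore a left \<open>S\<close>-module \<open>X\<close> is torsionless or reflexive
  exactly if it is so with respect to \<open>P\<close>: maps \<open>X \<rightarrow> P\<close> separate points, and every right linear
  functional \<open>Hom\<^sub>S(X,P) \<rightarrow> P\<close> is evaluation at a point (\<open>torsionless_iff_coeff\<close>,
  \<open>reflexive_iff_coeff\<close>). The same holds for \<open>R\<close>, \<open>W\<close> and \<open>R\<close>-modules.

  It remains to compare \<open>Hom\<^sub>S(X,P)\<close> with \<open>Hom\<^sub>R(X,W)\<close> for an \<open>R\<close>-module \<open>X\<close>. An isomorphism
  \<open>\<sigma>: Hom\<^sub>S(R,P) \<rightarrow> W\<close> gives an \<open>S\<close>-bimodule map \<open>\<tau>: W \<rightarrow> P\<close>, \<open>\<tau>(w) = \<sigma>\<^sup>-\<^sup>1(w)(1)\<close>, and by the adjunction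
  between restriction and coinduction every \<open>S\<close>-linear map \<open>X \<rightarrow> P\<close> is \<open>\<tau> \<circ> g\<close> for exactly one
  \<open>R\<close>-linear map \<open>g: X \<rightarrow> W\<close> (\<open>left_lift\<close>, \<open>left_separation\<close>).

  The mirror image of this property, for right modules, is where the reflexivity of \<open>\<^sub>SR\<close> enters.
  Reflexivity says that the right \<open>S\<close>-linear maps \<open>W \<rightarrow> P\<close> are precisely the maps \<open>w \<mapsto> \<tau>(r w)\<close>, each for one
  \<open>r\<close> in \<open>R\<close> (\<open>scalar_functional\<close>). Since \<open>W\<close> is also a generator on the right, this determines the
  right \<open>S\<close>-linear maps out of \<open>R\<close> as well: they are the maps \<open>r \<mapsto> \<tau>(w r)\<close>, each for one \<open>w\<close> in \<open>W\<close>
  (\<open>right_lift\<close>, \<open>right_separation\<close>). Hence right linear functionals \<open>\<Phi>\<close> on \<open>Hom\<^sub>S(X,P)\<close> and \<open>\<Psi>\<close> on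
  \<open>Hom\<^sub>R(X,W)\<close> correspond to one another by \<open>\<Phi>(\<tau> \<circ> g) = \<tau>(\<Psi>(g))\<close>, and one is evaluation at a
  point of \<open>X\<close> if and only if the other is.

  Finite sums such as the dual basis expansion \<open>p = \<Sum> y\<^sub>i(p) p\<^sub>i\<close> never occur with indices. The
  elements that have such an expansion form an inductively defined set, and a consequence of the
  expansion is proved by induction for all elements of this set.
\<close>

section \<open>Linear maps\<close>

lemma restrict_lin_hom:
  assumes "left_module S X"
    and "\<And>x. x \<in> carrier X \<Longrightarrow> g x \<in> carrier Y"
    and "\<And>x y. x \<in> carrier X \<Longrightarrow> y \<in> carrier X \<Longrightarrow> g (x \<oplus>\<^bsub>X\<^esub> y) = g x \<oplus>\<^bsub>Y\<^esub> g y"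
    and "\<And>s x. s \<in> carrier S \<Longrightarrow> x \<in> carrier X \<Longrightarrow> g (s \<odot>\<^bsub>X\<^esub> x) = s \<odot>\<^bsub>Y\<^esub> g x"
  shows "(\<lambda>x\<in>carrier X. g x) \<in> lin_hom S X Y"
proof -
  interpret left_module S X by fact
  show ?thesis
    unfolding lin_hom_def using assms(2-) smult_closed by auto
qed

lemma lin_hom_closed: "f \<in> lin_hom S X Y \<Longrightarrow> x \<in> carrier X \<Longrightarrow> f x \<in> carrier Y"
  by (auto simp: lin_hom_def)

lemma lin_hom_add:
  "f \<in> lin_hom S X Y \<Longrightarrow> x \<in> carrier X \<Longrightarrow> y \<in> carrier X \<Longrightarrow> f (x \<oplus>\<^bsub>X\<^esub> y) = f x \<oplus>\<^bsub>Y\<^esub> f y"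
  by (auto simp: lin_hom_def)

lemma lin_hom_smult:
  "f \<in> lin_hom S X Y \<Longrightarrow> s \<in> carrier S \<Longrightarrow> x \<in> carrier X \<Longrightarrow> f (s \<odot>\<^bsub>X\<^esub> x) = s \<odot>\<^bsub>Y\<^esub> f x"
  by (auto simp: lin_hom_def)

lemma lin_hom_eqI:
  "f \<in> lin_hom S X Y \<Longrightarrow> g \<in> lin_hom S X Y' \<Longrightarrow> (\<And>x. x \<in> carrier X \<Longrightarrow> f x = g x) \<Longrightarrow> f = g"
  by (rule extensionalityI[of _ "carrier X"]) (auto simp: lin_hom_def PiE_def)

lemma lin_hom_restrict_id: "f \<in> lin_hom S X Y \<Longrightarrow> (\<lambda>x\<in>carrier X. f x) = f"
  by (auto simp: lin_hom_def PiE_def)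

lemma left_module_0_smult:
  assumes "left_module S X" "x \<in> carrier X"
  shows "\<zero>\<^bsub>S\<^esub> \<odot>\<^bsub>X\<^esub> x = \<zero>\<^bsub>X\<^esub>"
proof -
  interpret left_module S X by fact
  have "\<zero>\<^bsub>S\<^esub> \<odot>\<^bsub>X\<^esub> x \<oplus>\<^bsub>X\<^esub> \<zero>\<^bsub>S\<^esub> \<odot>\<^bsub>X\<^esub> x = \<zero>\<^bsub>S\<^esub> \<odot>\<^bsub>X\<^esub> x"
    using smult_l_distr[of "\<zero>\<^bsub>S\<^esub>" "\<zero>\<^bsub>S\<^esub>" x] assms by simp
  then show ?thesis
    using smult_closed[of "\<zero>\<^bsub>S\<^esub>" x] assms(2)
      M.add.l_cancel_one[of "\<zero>\<^bsub>S\<^esub> \<odot>\<^bsub>X\<^esub> x" "\<zero>\<^bsub>S\<^esub> \<odot>\<^bsub>X\<^esub> x"] by simp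
qed

lemma left_module_minus_smult:
  assumes "left_module S X" "x \<in> carrier X"
  shows "(\<ominus>\<^bsub>S\<^esub> \<one>\<^bsub>S\<^esub>) \<odot>\<^bsub>X\<^esub> x = \<ominus>\<^bsub>X\<^esub> x"
proof -
  interpret left_module S X by fact
  have "(\<ominus>\<^bsub>S\<^esub> \<one>\<^bsub>S\<^esub>) \<odot>\<^bsub>X\<^esub> x \<oplus>\<^bsub>X\<^esub> x = \<zero>\<^bsub>X\<^esub>"
    using smult_l_distr[of "\<ominus>\<^bsub>S\<^esub> \<one>\<^bsub>S\<^esub>" "\<one>\<^bsub>S\<^esub>" x] assms(2)
    by (simp add: smult_one left_module_0_smult[OF assms] R.l_neg)
  then show ?thesis
    using smult_closed assms(2) by (simp add: M.minus_equality)
qed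

lemma left_module_smult_zero:
  assumes "left_module S X" "s \<in> carrier S"
  shows "s \<odot>\<^bsub>X\<^esub> \<zero>\<^bsub>X\<^esub> = \<zero>\<^bsub>X\<^esub>"
proof -
  interpret left_module S X by fact
  have "s \<odot>\<^bsub>X\<^esub> \<zero>\<^bsub>X\<^esub> \<oplus>\<^bsub>X\<^esub> s \<odot>\<^bsub>X\<^esub> \<zero>\<^bsub>X\<^esub> = s \<odot>\<^bsub>X\<^esub> \<zero>\<^bsub>X\<^esub>"
    using smult_r_distr[of s "\<zero>\<^bsub>X\<^esub>" "\<zero>\<^bsub>X\<^esub>"] assms by simp
  then show ?thesis
    using smult_closed[of s "\<zero>\<^bsub>X\<^esub>"] assms(2)
      M.add.l_cancel_one[of "s \<odot>\<^bsub>X\<^esub> \<zero>\<^bsub>X\<^esub>" "s \<odot>\<^bsub>X\<^esub> \<zero>\<^bsub>X\<^esub>"] by simp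
qed

lemma lin_hom_const_zero:
  assumes "left_module S X" "left_module S Y"
  shows "(\<lambda>x\<in>carrier X. \<zero>\<^bsub>Y\<^esub>) \<in> lin_hom S X Y"
proof -
  interpret Y: left_module S Y by fact
  show ?thesis
    by (rule restrict_lin_hom[OF assms(1)]) (simp_all add: left_module_smult_zero[OF assms(2)])
qed

lemma lin_hom_compose:
  assumes "left_module S X" "f \<in> lin_hom S X Y" "g \<in> lin_hom S Y Z"
  shows "compose (carrier X) g f \<in> lin_hom S X Z"
  unfolding compose_def
  by (rule restrict_lin_hom[OF assms(1)])
    (use assms(2,3) in \<open>simp_all add: lin_hom_closed lin_hom_add lin_hom_smult\<close>)

lemma lin_hom_sum:
  assumes "left_module S X" "left_module S Y" "f \<in> lin_hom S X Y" "g \<in> lin_hom S X Y"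
  shows "(\<lambda>x\<in>carrier X. f x \<oplus>\<^bsub>Y\<^esub> g x) \<in> lin_hom S X Y"
proof -
  interpret Y: left_module S Y by fact
  show ?thesis
    by (rule restrict_lin_hom[OF assms(1)])
      (use assms(3,4) in \<open>simp_all add: lin_hom_closed lin_hom_add lin_hom_smult
        Y.M.a_ac Y.smult_r_distr\<close>)
qed

lemma lin_hom_id:
  "left_module S X \<Longrightarrow> (\<lambda>x\<in>carrier X. x) \<in> lin_hom S X X"
  by (rule restrict_lin_hom) auto

lemma regular_module_simps [simp]:
  "carrier (regular_module S) = carrier S" "add (regular_module S) = add S"
  "zero (regular_module S) = zero S" "smult (regular_module S) = mult S"
  by (simp_all add: regular_module_def with_action_def)

lemma abelian_group_cong:
  assumes "abelian_group A" "carrier B = carrier A" "add B = add A" "zero B = zero A"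
  shows "abelian_group B"
proof -
  interpret abelian_group A by fact
  show ?thesis
    by (rule abelian_groupI) (auto simp: assms(2-4) a_ac intro: bexI[of _ "\<ominus>\<^bsub>A\<^esub> _"] l_neg)
qed

lemma regular_left_module:
  assumes "ring S" shows "left_module S (regular_module S)"
proof -
  interpret ring S by fact
  show ?thesis
  proof (intro left_module.intro left_module_axioms.intro)
    show "abelian_group (regular_module S)"
      by (rule abelian_group_cong[of S]) (simp_all add: abelian_group_axioms)
  qed (simp_all add: ring_axioms l_distr r_distr m_assoc)
qed

text \<open>A functional \<open>y\<close> followed by the map \<open>s \<mapsto> s p\<close> from the regular module.\<close>

lemma scalar_lin_hom:
  assumes "left_module S X" "left_module S Y" "y \<in> lin_hom S X (regular_module S)" "p \<in> carrier Y"
  shows "(\<lambda>x\<in>carrier X. y x \<odot>\<^bsub>Y\<^esub> p) \<in> lin_hom S X Y"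
proof -
  interpret Y: left_module S Y by fact
  have "y x \<in> carrier S" if "x \<in> carrier X" for x
    using lin_hom_closed[OF assms(3) that] by simp
  then show ?thesis
    by (intro restrict_lin_hom[OF assms(1)])
      (use assms(3,4) in \<open>simp_all add: Y.smult_closed lin_hom_add lin_hom_smult
        Y.smult_l_distr Y.smult_assoc\<close>)
qed


section \<open>Modules carried along a map\<close>

text \<open>The structure induced on the image of \<open>M\<close> under a map \<open>q\<close> whose fibres are congruence classes.
  An injective \<open>q\<close> gives a copy of \<open>M\<close> in another type, a map that picks representatives gives a
  quotient of \<open>M\<close>. Both are needed because an equivalence of module categories speaks only of modules
  inside one universe type.\<close>

definition image_module ::
    "('a \<Rightarrow> 'b) \<Rightarrow> ('s, 'a, 'm) module_scheme \<Rightarrow> ('s, 'b) module" where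
  "image_module q M = \<lparr>carrier = q ` carrier M, mult = undefined, one = undefined, zero = q \<zero>\<^bsub>M\<^esub>,
     add = (\<lambda>a b. q (inv_into (carrier M) q a \<oplus>\<^bsub>M\<^esub> inv_into (carrier M) q b)),
     smult = (\<lambda>s a. q (s \<odot>\<^bsub>M\<^esub> inv_into (carrier M) q a))\<rparr>"

lemma image_module_carrier [simp]: "carrier (image_module q M) = q ` carrier M"
  by (simp add: image_module_def)

locale module_congruence = left_module S M for S and M (structure) +
  fixes q
  assumes cong_add: "\<lbrakk>x \<in> carrier M; x' \<in> carrier M; y \<in> carrier M; y' \<in> carrier M;
      q x = q x'; q y = q y'\<rbrakk> \<Longrightarrow> q (x \<oplus> y) = q (x' \<oplus> y')"
    and cong_smult: "\<lbrakk>s \<in> carrier S; x \<in> carrier M; x' \<in> carrier M; q x = q x'\<rbrakk> \<Longrightarrow>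
      q (s \<odot> x) = q (s \<odot> x')"
begin

lemma image_add:
  "x \<in> carrier M \<Longrightarrow> y \<in> carrier M \<Longrightarrow> q x \<oplus>\<^bsub>image_module q M\<^esub> q y = q (x \<oplus> y)"
  by (simp add: image_module_def) (rule cong_add; simp add: inv_into_into f_inv_into_f)

lemma image_smult:
  "s \<in> carrier S \<Longrightarrow> x \<in> carrier M \<Longrightarrow> s \<odot>\<^bsub>image_module q M\<^esub> q x = q (s \<odot> x)"
  by (simp add: image_module_def) (rule cong_smult; simp add: inv_into_into f_inv_into_f)

lemma image_zero: "\<zero>\<^bsub>image_module q M\<^esub> = q \<zero>"
  by (simp add: image_module_def)

lemma image_left_module: "left_module S (image_module q M)"
proof (intro left_module.intro left_module_axioms.intro)
  show "ring S" by (rule R.ring_axioms)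
  show "abelian_group (image_module q M)"
  proof (rule abelian_groupI)
    fix x assume "x \<in> carrier (image_module q M)"
    then obtain a where "x = q a" "a \<in> carrier M" by auto
    then show "\<exists>y\<in>carrier (image_module q M). y \<oplus>\<^bsub>image_module q M\<^esub> x = \<zero>\<^bsub>image_module q M\<^esub>"
      by (intro bexI[of _ "q (\<ominus> a)"]) (auto simp: image_add image_zero M.l_neg)
  qed (auto simp: image_add image_zero M.a_ac)
qed (auto simp: image_add image_smult smult_closed smult_l_distr smult_r_distr smult_assoc smult_one)

lemma image_projection: "(\<lambda>x\<in>carrier M. q x) \<in> lin_hom S M (image_module q M)"
  by (rule restrict_lin_hom[OF left_module_axioms]) (auto simp: image_add image_smult)

end

lemma (in left_module) injective_congruence:
  "inj_on q (carrier M) \<Longrightarrow> module_congruence R M q"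
  by unfold_locales (auto simp: smult_closed dest: inj_onD)


section \<open>Quotients and traces\<close>

locale submodule = left_module S M for S and M (structure) +
  fixes T
  assumes sub: "T \<subseteq> carrier M"
    and zero_mem: "\<zero> \<in> T"
    and add_mem: "x \<in> T \<Longrightarrow> y \<in> T \<Longrightarrow> x \<oplus> y \<in> T"
    and smult_mem: "s \<in> carrier S \<Longrightarrow> x \<in> T \<Longrightarrow> s \<odot> x \<in> T"
begin

text \<open>Picking representatives instead of forming cosets keeps the quotient by \<open>T\<close> inside the type of
  \<open>M\<close>, hence inside the universe that \<open>M\<close> belongs to.\<close>

definition representative where
  "representative x = (SOME y. y \<in> carrier M \<and> y \<ominus> x \<in> T)"

lemma minus_mem: "x \<in> T \<Longrightarrow> \<ominus> x \<in> T"
  using smult_mem[of "\<ominus>\<^bsub>S\<^esub> \<one>\<^bsub>S\<^esub>" x] sub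
  by (auto simp: left_module_minus_smult[OF left_module_axioms])

lemma minus_zero: "\<ominus> \<zero> = \<zero>"
  using M.minus_equality[of \<zero> \<zero>] by simp

lemma difference_swap:
  assumes "x \<in> carrier M" "y \<in> carrier M" "y \<ominus> x \<in> T" shows "x \<ominus> y \<in> T"
proof -
  have "x \<ominus> y = \<ominus> (y \<ominus> x)"
    using assms(1,2) by (simp add: M.minus_eq M.minus_add M.a_comm)
  then show ?thesis using minus_mem[OF assms(3)] by simp
qed

lemma difference_trans:
  assumes "x \<in> carrier M" "y \<in> carrier M" "z \<in> carrier M" "x \<ominus> y \<in> T" "y \<ominus> z \<in> T"
  shows "x \<ominus> z \<in> T"
proof -
  have "(x \<ominus> y) \<oplus> (y \<ominus> z) = x \<oplus> ((\<ominus> y \<oplus> y) \<oplus> \<ominus> z)"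
    using assms(1-3) by (simp add: M.minus_eq M.a_assoc)
  also have "\<dots> = x \<ominus> z" using assms(1-3) by (simp add: M.l_neg M.minus_eq)
  finally show ?thesis using add_mem[OF assms(4,5)] by simp
qed

lemma representative_eq_iff:
  assumes "x \<in> carrier M" "y \<in> carrier M"
  shows "representative x = representative y \<longleftrightarrow> x \<ominus> y \<in> T"
proof
  have rep: "representative z \<in> carrier M \<and> representative z \<ominus> z \<in> T" if "z \<in> carrier M" for z
    unfolding representative_def using that zero_mem
    by (intro someI[of "\<lambda>y. y \<in> carrier M \<and> y \<ominus> z \<in> T" z]) (simp add: M.minus_eq M.r_neg)
  assume "representative x = representative y"
  then show "x \<ominus> y \<in> T"
    using rep[of x] rep[of y] assms difference_swap difference_trans by metis
next
  assume "x \<ominus> y \<in> T"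
  then have "(\<lambda>z. z \<in> carrier M \<and> z \<ominus> x \<in> T) = (\<lambda>z. z \<in> carrier M \<and> z \<ominus> y \<in> T)"
    using assms difference_swap difference_trans by blast
  then show "representative x = representative y"
    by (simp add: representative_def)
qed

lemma quotient: "module_congruence S M representative"
proof unfold_locales
  fix x x' y y'
  assume c: "x \<in> carrier M" "x' \<in> carrier M" "y \<in> carrier M" "y' \<in> carrier M"
    and eq: "representative x = representative x'" "representative y = representative y'"
  have "(x \<oplus> y) \<ominus> (x' \<oplus> y') = (x \<ominus> x') \<oplus> (y \<ominus> y')"
    using c by (simp add: M.minus_eq M.minus_add M.a_ac)
  then show "representative (x \<oplus> y) = representative (x' \<oplus> y')"
    using eq c add_mem by (simp add: representative_eq_iff)
next
  fix s x x'
  assume c: "s \<in> carrier S" "x \<in> carrier M" "x' \<in> carrier M"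
    and eq: "representative x = representative x'"
  have "s \<odot> (\<ominus> x') = \<ominus> (s \<odot> x')"
    using c M.minus_equality[of "s \<odot> (\<ominus> x')" "s \<odot> x'"] smult_r_distr[of s "\<ominus> x'" x']
    by (simp add: M.l_neg smult_closed left_module_smult_zero[OF left_module_axioms])
  then have "s \<odot> x \<ominus> s \<odot> x' = s \<odot> (x \<ominus> x')"
    using c by (simp add: M.minus_eq smult_r_distr)
  then show "representative (s \<odot> x) = representative (s \<odot> x')"
    using eq c smult_mem by (simp add: representative_eq_iff smult_closed)
qed

end

inductive_set trace ::
    "('s, 'k) ring_scheme \<Rightarrow> ('s, 'a, 'm) module_scheme \<Rightarrow> ('s, 'b, 'n) module_scheme \<Rightarrow> 'b set"
  for S A M where
  trace_value: "f \<in> lin_hom S A M \<Longrightarrow> a \<in> carrier A \<Longrightarrow> f a \<in> trace S A M"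
| trace_sum: "x \<in> trace S A M \<Longrightarrow> y \<in> trace S A M \<Longrightarrow> x \<oplus>\<^bsub>M\<^esub> y \<in> trace S A M"

lemma trace_submodule:
  assumes "left_module S A" "left_module S M"
  shows "submodule S M (trace S A M)"
proof -
  interpret A: left_module S A by fact
  interpret M: left_module S M by fact
  have sub: "x \<in> carrier M" if "x \<in> trace S A M" for x
    using that by induction (auto simp: lin_hom_closed)
  show ?thesis
  proof unfold_locales
    show "\<zero>\<^bsub>M\<^esub> \<in> trace S A M"
      using trace_value[OF lin_hom_const_zero[OF assms], of "\<zero>\<^bsub>A\<^esub>"] by simp
  next
    fix s x assume s: "s \<in> carrier S" and "x \<in> trace S A M"
    from this(2) show "s \<odot>\<^bsub>M\<^esub> x \<in> trace S A M"
    proof induction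
      case (trace_value f a)
      then show ?case
        using trace.trace_value[of f S A M "s \<odot>\<^bsub>A\<^esub> a"] s
        by (simp add: lin_hom_smult A.smult_closed)
    next
      case (trace_sum x y)
      then show ?case
        using trace.trace_sum[of "s \<odot>\<^bsub>M\<^esub> x" S A M "s \<odot>\<^bsub>M\<^esub> y"] s sub
        by (simp add: M.smult_r_distr)
    qed
  qed (auto simp: sub intro: trace_sum)
qed

text \<open>If maps out of \<open>M\<close> are determined by their restrictions to the images of \<open>A\<close>, the trace of \<open>A\<close>
  is all of \<open>M\<close>: the projection to the quotient by the trace agrees with zero on these images.\<close>

lemma generator_trace:
  fixes M :: "('s, 'u) module"
  assumes A: "left_module S A" and M: "left_module S M"
    and separating: "\<And>(N :: ('s, 'u) module) h h'. \<lbrakk>left_module S N; h \<in> lin_hom S M N;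
      h' \<in> lin_hom S M N; \<And>f a. f \<in> lin_hom S A M \<Longrightarrow> a \<in> carrier A \<Longrightarrow> h (f a) = h' (f a)\<rbrakk> \<Longrightarrow>
      h = h'"
  shows "trace S A M = carrier M"
proof -
  interpret submodule S M "trace S A M" by (rule trace_submodule[OF A M])
  interpret module_congruence S M representative by (rule quotient)
  let ?N = "image_module representative M"
  have N: "left_module S ?N" by (rule image_left_module)
  let ?h = "\<lambda>x\<in>carrier M. representative x"
  let ?z = "\<lambda>x\<in>carrier M. \<zero>\<^bsub>?N\<^esub>"
  have eq: "?h = ?z"
  proof (rule separating[OF N image_projection lin_hom_const_zero[OF M N]])
    fix f a assume "f \<in> lin_hom S A M" "a \<in> carrier A"
    then have "f a \<in> trace S A M" "f a \<in> carrier M"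
      by (auto simp: trace_value lin_hom_closed)
    then show "?h (f a) = ?z (f a)"
      by (simp add: image_zero representative_eq_iff M.minus_eq minus_zero)
  qed
  have "x \<in> trace S A M" if x: "x \<in> carrier M" for x
  proof -
    have "representative x = representative \<zero>\<^bsub>M\<^esub>"
      using fun_cong[OF eq, of x] x by (simp add: image_zero)
    then show ?thesis
      using x by (simp add: representative_eq_iff M.minus_eq minus_zero)
  qed
  then show ?thesis using sub by blast
qed


section \<open>Equivalences are full, faithful and essentially surjective\<close>

locale category =
  fixes C :: "('o, 'm) cat"
  assumes ident_arr: "X \<in> obj C \<Longrightarrow> ident C X \<in> arr C X X"
    and comp_arr: "\<lbrakk>X \<in> obj C; Y \<in> obj C; Z \<in> obj C; f \<in> arr C X Y; g \<in> arr C Y Z\<rbrakk> \<Longrightarrow>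
      comp C X Y Z g f \<in> arr C X Z"
    and comp_assoc: "\<lbrakk>W \<in> obj C; X \<in> obj C; Y \<in> obj C; Z \<in> obj C; f \<in> arr C W X; g \<in> arr C X Y;
      h \<in> arr C Y Z\<rbrakk> \<Longrightarrow> comp C W Y Z h (comp C W X Y g f) = comp C W X Z (comp C X Y Z h g) f"
    and ident_left: "\<lbrakk>X \<in> obj C; Y \<in> obj C; f \<in> arr C X Y\<rbrakk> \<Longrightarrow> comp C X Y Y (ident C Y) f = f"
    and ident_right: "\<lbrakk>X \<in> obj C; Y \<in> obj C; f \<in> arr C X Y\<rbrakk> \<Longrightarrow> comp C X X Y f (ident C X) = f"
begin

lemma cancel_left:
  assumes "Z \<in> obj C" "X \<in> obj C" "Y \<in> obj C" "is_iso C X Y u"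
    and "f \<in> arr C Z X" "g \<in> arr C Z X" "comp C Z X Y u f = comp C Z X Y u g"
  shows "f = g"
  using assms unfolding is_iso_def by (metis comp_assoc ident_left)

lemma cancel_right:
  assumes "Z \<in> obj C" "X \<in> obj C" "Y \<in> obj C" "is_iso C X Y u"
    and "f \<in> arr C Y Z" "g \<in> arr C Y Z" "comp C X Y Z f u = comp C X Y Z g u"
  shows "f = g"
  using assms unfolding is_iso_def by (metis comp_assoc ident_right)

lemma faithful_if_from_identity:
  assumes "naturally_isomorphic C C id_functor H" "\<And>X. X \<in> obj C \<Longrightarrow> on_obj H X \<in> obj C"
    and "X \<in> obj C" "Y \<in> obj C" "f \<in> arr C X Y" "g \<in> arr C X Y"
    and eq: "on_arr H X Y f = on_arr H X Y g"
  shows "f = g"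
proof -
  obtain \<eta> where "\<forall>X\<in>obj C. is_iso C X (on_obj H X) (\<eta> X)"
    and "\<forall>X\<in>obj C. \<forall>Y\<in>obj C. \<forall>f\<in>arr C X Y.
      comp C X Y (on_obj H Y) (\<eta> Y) f = comp C X (on_obj H X) (on_obj H Y) (on_arr H X Y f) (\<eta> X)"
    using assms(1) by (auto simp: naturally_isomorphic_def id_functor_def)
  note \<eta> = this(1)[rule_format] and nat = this(2)[rule_format]
  show ?thesis
    using cancel_left[OF \<open>X \<in> obj C\<close> \<open>Y \<in> obj C\<close> assms(2) \<eta>] nat assms(3-) by metis
qed

lemma faithful_if_to_identity:
  assumes "naturally_isomorphic C C H id_functor" "\<And>X. X \<in> obj C \<Longrightarrow> on_obj H X \<in> obj C"
    and "X \<in> obj C" "Y \<in> obj C" "f \<in> arr C X Y" "g \<in> arr C X Y"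
    and eq: "on_arr H X Y f = on_arr H X Y g"
  shows "f = g"
proof -
  obtain \<epsilon> where "\<forall>X\<in>obj C. is_iso C (on_obj H X) X (\<epsilon> X)"
    and "\<forall>X\<in>obj C. \<forall>Y\<in>obj C. \<forall>f\<in>arr C X Y.
      comp C (on_obj H X) (on_obj H Y) Y (\<epsilon> Y) (on_arr H X Y f) = comp C (on_obj H X) X Y f (\<epsilon> X)"
    using assms(1) by (auto simp: naturally_isomorphic_def id_functor_def)
  note \<epsilon> = this(1)[rule_format] and nat = this(2)[rule_format]
  show ?thesis
    using cancel_right[OF \<open>Y \<in> obj C\<close> assms(2) \<open>X \<in> obj C\<close> \<epsilon>] nat assms(3-) by metis
qed

end

lemma equivalence_faithful:
  assumes C: "category C" and F: "is_equivalence C D F"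
    and "X \<in> obj C" "Y \<in> obj C" "f \<in> arr C X Y" "g \<in> arr C X Y"
    and eq: "on_arr F X Y f = on_arr F X Y g"
  shows "f = g"
proof -
  interpret category C by fact
  obtain G where G: "is_functor C D F" "is_functor D C G"
    "naturally_isomorphic C C id_functor (comp_functor G F)"
    using F unfolding is_equivalence_def by blast
  show ?thesis
    by (rule faithful_if_from_identity[OF G(3)])
      (use G(1,2) assms in \<open>auto simp: comp_functor_def is_functor_def\<close>)
qed

text \<open>With \<open>G\<close> quasi-inverse to \<open>F\<close> and \<open>\<eta>: 1 \<rightarrow> GF\<close> the natural isomorphism, the preimage of
  \<open>h: F X \<rightarrow> F Y\<close> is \<open>\<eta>\<^sub>Y\<^sup>-\<^sup>1 \<circ> G h \<circ> \<eta>\<^sub>X\<close>; naturality shows that its image under \<open>GF\<close> is \<open>G h\<close>, and \<open>G\<close>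
  is faithful.\<close>

lemma equivalence_full:
  assumes C: "category C" and D: "category D" and F: "is_equivalence C D F"
    and X: "X \<in> obj C" and Y: "Y \<in> obj C" and h: "h \<in> arr D (on_obj F X) (on_obj F Y)"
  shows "\<exists>f\<in>arr C X Y. on_arr F X Y f = h"
proof -
  interpret C: category C by fact
  interpret D: category D by fact
  obtain G where F1: "is_functor C D F" and G1: "is_functor D C G"
    and GF: "naturally_isomorphic C C id_functor (comp_functor G F)"
    and FG: "naturally_isomorphic D D (comp_functor F G) id_functor"
    using F unfolding is_equivalence_def by blast
  let ?F = "on_obj F" and ?G = "on_obj G"
  let ?GX = "?G (?F X)" and ?GY = "?G (?F Y)"
  obtain \<eta> where "\<forall>X\<in>obj C. is_iso C X (?G (?F X)) (\<eta> X)"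
    and "\<forall>X\<in>obj C. \<forall>Y\<in>obj C. \<forall>f\<in>arr C X Y.
      comp C X Y (?G (?F Y)) (\<eta> Y) f =
      comp C X (?G (?F X)) (?G (?F Y)) (on_arr G (?F X) (?F Y) (on_arr F X Y f)) (\<eta> X)"
    using GF by (auto simp: naturally_isomorphic_def id_functor_def comp_functor_def)
  note \<eta> = this(1)[rule_format] and nat = this(2)[rule_format]
  have FX: "?F X \<in> obj D" "?F Y \<in> obj D" and GX: "?GX \<in> obj C" "?GY \<in> obj C"
    using F1 G1 X Y unfolding is_functor_def by auto
  have Gh: "on_arr G (?F X) (?F Y) h \<in> arr C ?GX ?GY"
    using G1 FX h unfolding is_functor_def by auto
  obtain v where v: "v \<in> arr C ?GY Y" "comp C ?GY Y ?GY (\<eta> Y) v = ident C ?GY"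
    using \<eta>[OF Y] unfolding is_iso_def by blast
  have \<eta>X: "\<eta> X \<in> arr C X ?GX" and \<eta>Y: "\<eta> Y \<in> arr C Y ?GY"
    using \<eta> X Y unfolding is_iso_def by auto
  define k where "k = comp C X ?GX ?GY (on_arr G (?F X) (?F Y) h) (\<eta> X)"
  have k: "k \<in> arr C X ?GY"
    unfolding k_def by (rule C.comp_arr) (use X GX Gh \<eta>X in auto)
  define f where "f = comp C X ?GY Y v k"
  have f: "f \<in> arr C X Y"
    unfolding f_def by (rule C.comp_arr) (use X Y GX v k in auto)
  have Ff: "on_arr F X Y f \<in> arr D (?F X) (?F Y)"
    using F1 X Y f unfolding is_functor_def by auto
  then have GFf: "on_arr G (?F X) (?F Y) (on_arr F X Y f) \<in> arr C ?GX ?GY"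
    using G1 FX unfolding is_functor_def by auto
  have "comp C X Y ?GY (\<eta> Y) f = k"
    unfolding f_def using C.comp_assoc[OF X GX(2) Y GX(2) k v(1) \<eta>Y] v(2) C.ident_left[OF X GX(2) k]
    by simp
  then have "on_arr G (?F X) (?F Y) (on_arr F X Y f) = on_arr G (?F X) (?F Y) h"
    by (intro C.cancel_right[OF GX(2) X GX(1) \<eta>[OF X] GFf Gh]) (simp add: nat[OF X Y f] k_def)
  then have "on_arr F X Y f = h"
    by (intro D.faithful_if_to_identity[OF FG _ FX Ff h])
      (use F1 G1 in \<open>auto simp: comp_functor_def is_functor_def\<close>)
  with f show ?thesis by blast
qed

lemma equivalence_essentially_surjective:
  assumes "is_equivalence C D F" "Y \<in> obj D"
  shows "\<exists>X\<in>obj C. \<exists>u. is_iso D (on_obj F X) Y u"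
proof -
  obtain G where "is_functor D C G" "naturally_isomorphic D D (comp_functor F G) id_functor"
    using assms(1) unfolding is_equivalence_def by blast
  with assms(2) show ?thesis
    unfolding is_functor_def naturally_isomorphic_def comp_functor_def id_functor_def by auto
qed

lemma module_category: "category (module_cat S)"
proof
  fix W X Y Z f g h
  assume "f \<in> arr (module_cat S) W X" and "W \<in> obj (module_cat S)"
    and "g \<in> arr (module_cat S) X Y" "h \<in> arr (module_cat S) Y Z"
  then show "comp (module_cat S) W Y Z h (comp (module_cat S) W X Y g f) =
    comp (module_cat S) W X Z (comp (module_cat S) X Y Z h g) f"
    by (auto simp: module_cat_def compose_def fun_eq_iff lin_hom_closed)
next
  fix X Y f assume "f \<in> arr (module_cat S) X Y"
  then have f: "f \<in> lin_hom S X Y" by (simp add: module_cat_def)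
  have "compose (carrier X) (\<lambda>y\<in>carrier Y. y) f = (\<lambda>x\<in>carrier X. f x)"
    "compose (carrier X) f (\<lambda>x\<in>carrier X. x) = (\<lambda>x\<in>carrier X. f x)"
    using lin_hom_closed[OF f] by (auto simp: compose_def restrict_def)
  then show "comp (module_cat S) X Y Y (ident (module_cat S) Y) f = f"
    "comp (module_cat S) X X Y f (ident (module_cat S) X) = f"
    by (simp_all add: module_cat_def lin_hom_restrict_id[OF f])
qed (auto simp: module_cat_def lin_hom_id lin_hom_compose)


section \<open>Invertible bimodules are progenerators\<close>

lemma opposite_ring_simps [simp]:
  "carrier (opposite_ring S) = carrier S" "add (opposite_ring S) = add S"
  "zero (opposite_ring S) = zero S" "one (opposite_ring S) = one S"
  "mult (opposite_ring S) = (\<lambda>a b. b \<otimes>\<^bsub>S\<^esub> a)"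
  by (simp_all add: opposite_ring_def)

lemma right_part_simps [simp]:
  "carrier (right_part B) = carrier B" "add (right_part B) = add B"
  "zero (right_part B) = zero B" "smult (right_part B) = rsmult B"
  by (simp_all add: right_part_def with_action_def)

lemma hom_left_simps [simp]:
  "carrier (hom_left S X Y) = lin_hom S X Y"
  "add (hom_left S X Y) = (\<lambda>f g. \<lambda>x\<in>carrier X. f x \<oplus>\<^bsub>Y\<^esub> g x)"
  "zero (hom_left S X Y) = (\<lambda>x\<in>carrier X. \<zero>\<^bsub>Y\<^esub>)"
  "smult (hom_left S X Y) = (\<lambda>r f. \<lambda>x\<in>carrier X. f (rsmult X r x))"
  by (simp_all add: hom_left_def with_action_def hom_group_def)

locale two_sided_module =
  fixes S :: "('s, 'k) ring_scheme" and R :: "('r, 'l) ring_scheme" and B :: "('s, 'r, 'b) bimodule"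
  assumes bimodule: "bimodule S R B"
begin

sublocale left_module S B
  using bimodule unfolding bimodule_def by blast

lemma right_module: "left_module (opposite_ring R) (right_part B)"
  using bimodule unfolding bimodule_def by blast

lemma rsmult_closed: "r \<in> carrier R \<Longrightarrow> x \<in> carrier B \<Longrightarrow> rsmult B r x \<in> carrier B"
  using left_module.smult_closed[OF right_module] by simp

lemma rsmult_r_distr: "\<lbrakk>r \<in> carrier R; x \<in> carrier B; y \<in> carrier B\<rbrakk> \<Longrightarrow>
    rsmult B r (x \<oplus>\<^bsub>B\<^esub> y) = rsmult B r x \<oplus>\<^bsub>B\<^esub> rsmult B r y"
  using left_module.smult_r_distr[OF right_module] by simp

lemma rsmult_l_distr: "\<lbrakk>r \<in> carrier R; r' \<in> carrier R; x \<in> carrier B\<rbrakk> \<Longrightarrow>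
    rsmult B (r \<oplus>\<^bsub>R\<^esub> r') x = rsmult B r x \<oplus>\<^bsub>B\<^esub> rsmult B r' x"
  using left_module.smult_l_distr[OF right_module] by simp

lemma rsmult_assoc: "\<lbrakk>r \<in> carrier R; r' \<in> carrier R; x \<in> carrier B\<rbrakk> \<Longrightarrow>
    rsmult B (r \<otimes>\<^bsub>R\<^esub> r') x = rsmult B r' (rsmult B r x)"
  using left_module.smult_assoc[OF right_module, of r' r x] by simp

lemma rsmult_one: "x \<in> carrier B \<Longrightarrow> rsmult B \<one>\<^bsub>R\<^esub> x = x"
  using left_module.smult_one[OF right_module] by simp

lemma rsmult_smult: "\<lbrakk>s \<in> carrier S; r \<in> carrier R; x \<in> carrier B\<rbrakk> \<Longrightarrow>
    rsmult B r (s \<odot>\<^bsub>B\<^esub> x) = s \<odot>\<^bsub>B\<^esub> rsmult B r x"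
  using bimodule unfolding bimodule_def by blast

end

text \<open>The linear maps \<open>X \<rightarrow> Y\<close> that factor through a finitely generated free module, that is, the sums
  of maps \<open>x \<mapsto> y(x) p\<close>. The identity of \<open>P\<close> is of this kind exactly if \<open>P\<close> has a finite dual basis,
  which means that \<open>P\<close> is finitely generated projective.\<close>

inductive_set finite_rank ::
    "('s, 'k) ring_scheme \<Rightarrow> ('s, 'x, 'm) module_scheme \<Rightarrow> ('s, 'y, 'n) module_scheme \<Rightarrow> ('x \<Rightarrow> 'y) set"
  for S X Y where
  rank_one: "y \<in> lin_hom S X (regular_module S) \<Longrightarrow> p \<in> carrier Y \<Longrightarrow>
    (\<lambda>x\<in>carrier X. y x \<odot>\<^bsub>Y\<^esub> p) \<in> finite_rank S X Y"
| rank_sum: "e \<in> finite_rank S X Y \<Longrightarrow> e' \<in> finite_rank S X Y \<Longrightarrow>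
    (\<lambda>x\<in>carrier X. e x \<oplus>\<^bsub>Y\<^esub> e' x) \<in> finite_rank S X Y"

text \<open>The three parts of Morita's theorem for \<open>Hom\<^sub>S(P,-)\<close>: the left module \<open>P\<close> is finitely generated
  projective, it is a generator, and \<open>S\<close> acts on the right as its full endomorphism ring.\<close>

locale progenerator_bimodule = two_sided_module S S P for S P +
  assumes identity_finite_rank: "(\<lambda>p\<in>carrier P. p) \<in> finite_rank S P P"
    and one_in_trace: "\<one>\<^bsub>S\<^esub> \<in> trace S P (regular_module S)"
    and endomorphism_scalar: "e \<in> lin_hom S P P \<Longrightarrow>
      \<exists>!s. s \<in> carrier S \<and> (\<forall>p\<in>carrier P. e p = rsmult P s p)"

lemma module_iso_inverse:
  assumes "left_module S X" "left_module S Y" "f \<in> module_iso S X Y"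
  shows "(\<lambda>y\<in>carrier Y. inv_into (carrier X) f y) \<in> lin_hom S Y X"
proof -
  interpret X: left_module S X by fact
  interpret Y: left_module S Y by fact
  have f: "f \<in> lin_hom S X Y" and inj: "inj_on f (carrier X)" and im: "f ` carrier X = carrier Y"
    using assms(3) by (auto simp: module_iso_def bij_betw_def)
  let ?g = "inv_into (carrier X) f"
  have g: "?g y \<in> carrier X" "f (?g y) = y" if "y \<in> carrier Y" for y
    using that im by (auto intro: inv_into_into f_inv_into_f)
  show ?thesis
  proof (rule restrict_lin_hom[OF assms(2)])
    fix x y assume "x \<in> carrier Y" "y \<in> carrier Y"
    then show "?g (x \<oplus>\<^bsub>Y\<^esub> y) = ?g x \<oplus>\<^bsub>X\<^esub> ?g y"
      by (intro inj_onD[OF inj]) (simp_all add: g lin_hom_add[OF f])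
  next
    fix s x assume "s \<in> carrier S" "x \<in> carrier Y"
    then show "?g (s \<odot>\<^bsub>Y\<^esub> x) = s \<odot>\<^bsub>X\<^esub> ?g x"
      by (intro inj_onD[OF inj]) (simp_all add: g lin_hom_smult[OF f] X.smult_closed Y.smult_closed)
  qed (simp add: g)
qed

lemma injective_image_module:
  assumes "left_module S M" "inj q"
  shows "left_module S (image_module q M)"
    and "(\<lambda>x\<in>carrier M. q x) \<in> module_iso S M (image_module q M)"
    and "(\<lambda>y\<in>carrier (image_module q M). inv_into UNIV q y) \<in> lin_hom S (image_module q M) M"
proof -
  interpret left_module S M by fact
  interpret module_congruence S M q
    by (rule injective_congruence) (rule inj_on_subset[OF assms(2)], simp)
  show 1: "left_module S (image_module q M)"
    by (rule image_left_module)
  show 2: "(\<lambda>x\<in>carrier M. q x) \<in> module_iso S M (image_module q M)"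
    using image_projection inj_on_subset[OF assms(2)] by (auto simp: module_iso_def bij_betw_def)
  have "inv_into (carrier M) (\<lambda>x\<in>carrier M. q x) (q x) = x" if "x \<in> carrier M" for x
    by (rule inv_into_f_eq) (use that 2 in \<open>auto simp: module_iso_def bij_betw_def\<close>)
  then have "(\<lambda>y\<in>carrier (image_module q M). inv_into (carrier M) (\<lambda>x\<in>carrier M. q x) y) =
    (\<lambda>y\<in>carrier (image_module q M). inv_into UNIV q y)"
    using assms(2) by (auto simp: fun_eq_iff)
  with module_iso_inverse[OF assms(1) 1 2]
  show "(\<lambda>y\<in>carrier (image_module q M). inv_into UNIV q y) \<in> lin_hom S (image_module q M) M"
    by simp
qed

lemma trace_map:
  assumes "left_module S A" "left_module S M" "g \<in> lin_hom S M N" "t \<in> trace S A M"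
  shows "g t \<in> trace S A N"
  using assms(4)
proof induction
  case (trace_value f a)
  then have "compose (carrier A) g f a \<in> trace S A N"
    by (intro trace.trace_value lin_hom_compose[OF assms(1) _ assms(3)])
  with trace_value show ?case by (simp add: compose_def)
next
  case (trace_sum x y)
  then have "x \<in> carrier M" "y \<in> carrier M"
    using submodule.sub[OF trace_submodule[OF assms(1,2)]] by auto
  with trace_sum show ?case
    by (simp add: lin_hom_add[OF assms(3)] trace.trace_sum)
qed

text \<open>The hypothesis that \<open>Hom\<^sub>S(P,-)\<close> is an equivalence in elementary terms, for any universe \<open>'u\<close> into
  which \<open>S\<close> and \<open>P\<close> embed.\<close>

locale hom_equivalence = two_sided_module S S P
  for S :: "('s, 'k) ring_scheme" and P :: "('s, 's, 'p) bimodule" +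
  fixes iS :: "'s \<Rightarrow> 'u" and iP :: "'p \<Rightarrow> 'u"
  assumes inj: "inj iS" "inj iP"
    and hom_module: "\<And>M :: ('s, 'u) module. left_module S M \<Longrightarrow> left_module S (hom_left S P M)"
    and hom_map: "\<And>(M :: ('s, 'u) module) (N :: ('s, 'u) module) f.
      \<lbrakk>left_module S M; left_module S N; f \<in> lin_hom S M N\<rbrakk> \<Longrightarrow>
      (\<lambda>h\<in>lin_hom S P M. compose (carrier P) f h) \<in> lin_hom S (hom_left S P M) (hom_left S P N)"
    and faithful: "\<And>(M :: ('s, 'u) module) (N :: ('s, 'u) module) f g.
      \<lbrakk>left_module S M; left_module S N; f \<in> lin_hom S M N; g \<in> lin_hom S M N;
       \<And>h. h \<in> lin_hom S P M \<Longrightarrow> compose (carrier P) f h = compose (carrier P) g h\<rbrakk> \<Longrightarrow> f = g"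
    and full: "\<And>(M :: ('s, 'u) module) (N :: ('s, 'u) module) h.
      \<lbrakk>left_module S M; left_module S N; h \<in> lin_hom S (hom_left S P M) (hom_left S P N)\<rbrakk> \<Longrightarrow>
      \<exists>f\<in>lin_hom S M N. \<forall>g\<in>lin_hom S P M. h g = compose (carrier P) f g"
    and essentially_surjective: "\<And>Z :: ('s, 'p \<Rightarrow> 'u) module. left_module S Z \<Longrightarrow>
      \<exists>M :: ('s, 'u) module. left_module S M \<and> module_iso S Z (hom_left S P M) \<noteq> {}"
begin

definition "copy_S = image_module iS (regular_module S)"
definition "copy_P = image_module iP P"

lemmas copy_S = injective_image_module[OF regular_left_module[OF R.ring_axioms] inj(1),
    folded copy_S_def]
lemmas copy_P = injective_image_module[OF left_module_axioms inj(2), folded copy_P_def]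

text \<open>Faithfulness says that maps out of \<open>M\<close> are determined on the images of \<open>P\<close>.\<close>

lemma generates:
  fixes M :: "('s, 'u) module"
  assumes "left_module S M" shows "trace S P M = carrier M"
proof (rule generator_trace[OF left_module_axioms assms])
  fix N :: "('s, 'u) module" and h h'
  assume "left_module S N" "h \<in> lin_hom S M N" "h' \<in> lin_hom S M N"
    and "\<And>f p. f \<in> lin_hom S P M \<Longrightarrow> p \<in> carrier P \<Longrightarrow> h (f p) = h' (f p)"
  then show "h = h'"
    by (intro faithful[OF assms]) (auto simp: compose_def)
qed

lemma one_in_trace: "\<one>\<^bsub>S\<^esub> \<in> trace S P (regular_module S)"
proof -
  have "iS \<one>\<^bsub>S\<^esub> \<in> trace S P copy_S"
    by (simp add: generates[OF copy_S(1)]) (simp add: copy_S_def)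
  from trace_map[OF left_module_axioms copy_S(1) copy_S(3) this]
  show ?thesis using inj(1) by (simp add: copy_S_def)
qed

lemma determined_by_scalars:
  assumes "left_module S M" "k \<in> lin_hom S M N" "k' \<in> lin_hom S M N'"
    and eq: "\<And>f. f \<in> lin_hom S copy_S M \<Longrightarrow> compose (carrier copy_S) k f = compose (carrier copy_S) k' f"
  shows "k = k'"
proof (rule lin_hom_eqI[OF assms(2,3)])
  interpret M: left_module S M by fact
  fix m assume m: "m \<in> carrier M"
  let ?f = "\<lambda>x\<in>carrier copy_S. (\<lambda>y\<in>carrier copy_S. inv_into UNIV iS y) x \<odot>\<^bsub>M\<^esub> m"
  have one: "iS \<one>\<^bsub>S\<^esub> \<in> carrier copy_S" by (simp add: copy_S_def)
  have "?f (iS \<one>\<^bsub>S\<^esub>) = m"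
    using one inj(1) m by (simp add: M.smult_one)
  moreover have "compose (carrier copy_S) k ?f (iS \<one>\<^bsub>S\<^esub>) = compose (carrier copy_S) k' ?f (iS \<one>\<^bsub>S\<^esub>)"
    using eq[OF scalar_lin_hom[OF copy_S(1) assms(1) copy_S(3) m]] by simp
  ultimately show "k m = k' m"
    using one by (simp add: compose_def)
qed

text \<open>Scalars determine maps in the category of \<open>S\<close>-modules, and the equivalence carries this property
  of \<open>S\<close> to \<open>Hom\<^sub>S(P,S)\<close>. Maps \<open>h\<close>, \<open>h'\<close> from \<open>Hom\<^sub>S(P,M)\<close> into an arbitrary module \<open>N\<close> are treated
  by replacing \<open>N\<close> with an isomorphic \<open>Hom\<^sub>S(P,L)\<close> and lifting them to maps \<open>M \<rightarrow> L\<close>.\<close>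

lemma hom_generates:
  fixes M :: "('s, 'u) module"
  assumes M: "left_module S M"
  shows "trace S (hom_left S P copy_S) (hom_left S P M) = lin_hom S P M"
proof -
  have "trace S (hom_left S P copy_S) (hom_left S P M) = carrier (hom_left S P M)"
  proof (rule generator_trace[OF hom_module[OF copy_S(1)] hom_module[OF M]])
    fix N :: "('s, 'p \<Rightarrow> 'u) module" and h h'
    assume N: "left_module S N" and h: "h \<in> lin_hom S (hom_left S P M) N"
      and h': "h' \<in> lin_hom S (hom_left S P M) N"
      and agree: "\<And>f y. f \<in> lin_hom S (hom_left S P copy_S) (hom_left S P M) \<Longrightarrow>
        y \<in> carrier (hom_left S P copy_S) \<Longrightarrow> h (f y) = h' (f y)"
    obtain L :: "('s, 'u) module" and v where L: "left_module S L"
      and v: "v \<in> lin_hom S N (hom_left S P L)" and v_inj: "inj_on v (carrier N)"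
      using essentially_surjective[OF N] by (auto simp: module_iso_def bij_betw_def)
    have lift: "\<exists>k\<in>lin_hom S M L. \<forall>g\<in>lin_hom S P M. v (d g) = compose (carrier P) k g"
      if "d \<in> lin_hom S (hom_left S P M) N" for d
      using full[OF M L lin_hom_compose[OF hom_module[OF M] that v]] by (simp add: compose_def)
    obtain k where k: "k \<in> lin_hom S M L" and kh: "\<And>g. g \<in> lin_hom S P M \<Longrightarrow> v (h g) = compose (carrier P) k g"
      using lift[OF h] by blast
    obtain k' where k': "k' \<in> lin_hom S M L" and kh': "\<And>g. g \<in> lin_hom S P M \<Longrightarrow> v (h' g) = compose (carrier P) k' g"
      using lift[OF h'] by blast
    have "k = k'"
    proof (rule determined_by_scalars[OF M k k'])
      fix f assume f: "f \<in> lin_hom S copy_S M"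
      show "compose (carrier copy_S) k f = compose (carrier copy_S) k' f"
      proof (rule faithful[OF copy_S(1) L])
        fix y assume y: "y \<in> lin_hom S P copy_S"
        have fy: "compose (carrier P) f y \<in> lin_hom S P M"
          by (rule lin_hom_compose[OF left_module_axioms y f])
        have "h (compose (carrier P) f y) = h' (compose (carrier P) f y)"
          using agree[OF hom_map[OF copy_S(1) M f], of y] y by simp
        then have "compose (carrier P) k (compose (carrier P) f y) =
          compose (carrier P) k' (compose (carrier P) f y)"
          using kh[OF fy] kh'[OF fy] by simp
        then show "compose (carrier P) (compose (carrier copy_S) k f) y =
          compose (carrier P) (compose (carrier copy_S) k' f) y"
          using lin_hom_closed[OF y] by (auto simp: compose_def fun_eq_iff split: if_splits)
      qed (use lin_hom_compose[OF copy_S(1) f] k k' in auto)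
    qed
    show "h = h'"
    proof (rule lin_hom_eqI[OF h h'])
      fix g assume g: "g \<in> carrier (hom_left S P M)"
      then have "v (h g) = v (h' g)"
        using kh[of g] kh'[of g] \<open>k = k'\<close> by simp
      then show "h g = h' g"
        by (rule inj_onD[OF v_inj _ lin_hom_closed[OF h g] lin_hom_closed[OF h' g]])
    qed
  qed
  then show ?thesis by simp
qed

text \<open>For \<open>M = P\<close> the trace of \<open>Hom\<^sub>S(P,S)\<close> contains the identity. By fullness a linear map
  \<open>Hom\<^sub>S(P,S) \<rightarrow> Hom\<^sub>S(P,P)\<close> is composition with some \<open>k: S \<rightarrow> P\<close>, so its values are the maps
  \<open>p \<mapsto> y(p) k(1)\<close>.\<close>

lemma identity_finite_rank: "(\<lambda>p\<in>carrier P. p) \<in> finite_rank S P P"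
proof -
  have fin: "(\<lambda>p\<in>carrier P. inv_into UNIV iP (z p)) \<in> finite_rank S P P"
    if "z \<in> trace S (hom_left S P copy_S) (hom_left S P copy_P)" for z
    using that
  proof induction
    case (trace_value f y)
    obtain k where k: "k \<in> lin_hom S copy_S copy_P"
      and fk: "\<And>g. g \<in> lin_hom S P copy_S \<Longrightarrow> f g = compose (carrier P) k g"
      using full[OF copy_S(1) copy_P(1) trace_value(1)] by blast
    have y: "y \<in> lin_hom S P copy_S" using trace_value(2) by simp
    have one: "iS \<one>\<^bsub>S\<^esub> \<in> carrier copy_S" by (simp add: copy_S_def)
    let ?y = "compose (carrier P) (\<lambda>x\<in>carrier copy_S. inv_into UNIV iS x) y"
    let ?p = "inv_into UNIV iP (k (iS \<one>\<^bsub>S\<^esub>))"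
    have ylin: "?y \<in> lin_hom S P (regular_module S)"
      by (rule lin_hom_compose[OF left_module_axioms y copy_S(3)])
    have kone: "k (iS \<one>\<^bsub>S\<^esub>) \<in> carrier copy_P"
      by (rule lin_hom_closed[OF k one])
    have pP: "?p \<in> carrier P"
      using lin_hom_closed[OF copy_P(3) kone] kone by simp
    have "inv_into UNIV iP (f y p) = ?y p \<odot>\<^bsub>P\<^esub> ?p" if p: "p \<in> carrier P" for p
    proof -
      have yp: "y p \<in> carrier copy_S" by (rule lin_hom_closed[OF y p])
      then obtain a where a: "a \<in> carrier S" "y p = iS a" by (auto simp: copy_S_def)
      have "iS a = a \<odot>\<^bsub>copy_S\<^esub> iS \<one>\<^bsub>S\<^esub>"
        using copy_S(2) lin_hom_smult[of "\<lambda>x\<in>carrier S. iS x" S "regular_module S" copy_S a "\<one>\<^bsub>S\<^esub>"] a(1)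
        by (simp add: module_iso_def)
      then have "k (iS a) = a \<odot>\<^bsub>copy_P\<^esub> k (iS \<one>\<^bsub>S\<^esub>)"
        using lin_hom_smult[OF k a(1) one] by simp
      moreover have "a \<odot>\<^bsub>copy_P\<^esub> k (iS \<one>\<^bsub>S\<^esub>) \<in> carrier copy_P"
        by (rule left_module.smult_closed[OF copy_P(1) a(1) kone])
      ultimately have "inv_into UNIV iP (k (iS a)) = a \<odot>\<^bsub>P\<^esub> ?p"
        using lin_hom_smult[OF copy_P(3) a(1) kone] kone by simp
      then show ?thesis
        using p yp a inj(1) by (simp add: fk[OF y] compose_def)
    qed
    then have "(\<lambda>p\<in>carrier P. inv_into UNIV iP (f y p)) = (\<lambda>p\<in>carrier P. ?y p \<odot>\<^bsub>P\<^esub> ?p)"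
      by (rule restrict_ext)
    then show ?case
      by (simp only: rank_one[OF ylin pP])
  next
    case (trace_sum x z)
    have "x \<in> lin_hom S P copy_P" "z \<in> lin_hom S P copy_P"
      using trace_sum(1,2) hom_generates[OF copy_P(1)] by auto
    then have add: "inv_into UNIV iP (x p \<oplus>\<^bsub>copy_P\<^esub> z p) = inv_into UNIV iP (x p) \<oplus>\<^bsub>P\<^esub> inv_into UNIV iP (z p)" if "p \<in> carrier P" for p
      using lin_hom_add[OF copy_P(3), of "x p" "z p"] lin_hom_closed that
        abelian_monoid.a_closed[of copy_P "x p" "z p"] copy_P(1)
      by (fastforce simp: left_module_def abelian_group_def)
    have "(\<lambda>p\<in>carrier P. inv_into UNIV iP ((x \<oplus>\<^bsub>hom_left S P copy_P\<^esub> z) p)) =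
      (\<lambda>p\<in>carrier P. (\<lambda>p\<in>carrier P. inv_into UNIV iP (x p)) p \<oplus>\<^bsub>P\<^esub>
        (\<lambda>p\<in>carrier P. inv_into UNIV iP (z p)) p)"
      by (rule restrict_ext) (simp add: add)
    then show ?case
      by (simp only: rank_sum[OF trace_sum(3,4)])
  qed
  have "(\<lambda>p\<in>carrier P. iP p) \<in> lin_hom S P copy_P"
    using copy_P(2) by (simp add: module_iso_def)
  then have "(\<lambda>p\<in>carrier P. inv_into UNIV iP ((\<lambda>p\<in>carrier P. iP p) p)) \<in> finite_rank S P P"
    by (intro fin) (simp only: hom_generates[OF copy_P(1)])
  moreover have "(\<lambda>p\<in>carrier P. inv_into UNIV iP ((\<lambda>p\<in>carrier P. iP p) p)) = (\<lambda>p\<in>carrier P. p)"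
    by (rule restrict_ext) (simp add: inj(2))
  ultimately show ?thesis by simp
qed

text \<open>Essential surjectivity yields \<open>Q\<close> with \<open>Hom\<^sub>S(P,Q) \<simeq> S\<close>. Let \<open>q: P \<rightarrow> Q\<close> correspond to the unit, so
  that every map \<open>P \<rightarrow> Q\<close> is \<open>p \<mapsto> q(p s)\<close> for one scalar \<open>s\<close>. A map \<open>g\<close> with \<open>g \<circ> q = 1\<close> exists by
  fullness, and applying it to \<open>q \<circ> e = q(- s)\<close> gives \<open>e(p) = p s\<close>.\<close>

lemma endomorphism_scalar:
  assumes e: "e \<in> lin_hom S P P"
  shows "\<exists>!s. s \<in> carrier S \<and> (\<forall>p\<in>carrier P. e p = rsmult P s p)"
proof -
  let ?i = "\<lambda>s (_ :: 'p). iS s"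
  let ?Z = "image_module ?i (regular_module S)"
  have S: "left_module S (regular_module S)" by (rule regular_left_module[OF R.ring_axioms])
  have i: "inj ?i" using inj(1) by (auto simp: inj_def fun_eq_iff)
  note Z = injective_image_module[OF S i]
  obtain Q :: "('s, 'u) module" and v where Q: "left_module S Q"
    and v: "v \<in> module_iso S ?Z (hom_left S P Q)"
    using essentially_surjective[OF Z(1)] by blast
  define \<alpha> where "\<alpha> = compose (carrier S) v (\<lambda>s\<in>carrier S. ?i s)"
  have \<alpha>: "\<alpha> \<in> module_iso S (regular_module S) (hom_left S P Q)"
  proof -
    have "\<alpha> \<in> lin_hom S (regular_module S) (hom_left S P Q)"
      using lin_hom_compose[OF S, of "\<lambda>s\<in>carrier S. ?i s" ?Z v "hom_left S P Q"] Z(2) v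
      by (simp add: \<alpha>_def module_iso_def)
    moreover have "bij_betw \<alpha> (carrier S) (lin_hom S P Q)"
      unfolding \<alpha>_def using Z(2) v by (auto simp: module_iso_def intro: bij_betw_compose)
    ultimately show ?thesis by (simp add: module_iso_def)
  qed
  then have \<alpha>_lin: "\<alpha> \<in> lin_hom S (regular_module S) (hom_left S P Q)"
    and \<alpha>_inj: "inj_on \<alpha> (carrier S)" and \<alpha>_im: "\<alpha> ` carrier S = lin_hom S P Q"
    by (auto simp: module_iso_def bij_betw_def)
  define q where "q = \<alpha> \<one>\<^bsub>S\<^esub>"
  have q: "q \<in> lin_hom S P Q" using \<alpha>_im unfolding q_def by blast
  have \<alpha>_eq: "\<alpha> s p = q (rsmult P s p)" if "s \<in> carrier S" "p \<in> carrier P" for s p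
    using lin_hom_smult[OF \<alpha>_lin that(1), of "\<one>\<^bsub>S\<^esub>"] that by (simp add: q_def)
  let ?\<iota> = "\<lambda>p\<in>carrier P. iP p"
  let ?c = "\<lambda>g\<in>carrier (hom_left S P Q). inv_into (carrier S) \<alpha> g"
  have \<iota>: "?\<iota> \<in> lin_hom S P copy_P" using copy_P(2) by (simp add: module_iso_def)
  have c: "?c \<in> lin_hom S (hom_left S P Q) (regular_module S)"
    using module_iso_inverse[OF S hom_module[OF Q] \<alpha>] by simp
  let ?h = "\<lambda>f\<in>carrier (hom_left S P Q). ?c f \<odot>\<^bsub>hom_left S P copy_P\<^esub> ?\<iota>"
  have h: "?h \<in> lin_hom S (hom_left S P Q) (hom_left S P copy_P)"
    by (rule scalar_lin_hom[OF hom_module[OF Q] hom_module[OF copy_P(1)] c])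
      (simp only: hom_left_simps \<iota>)
  \<comment> \<open>Fullness turns the linear map carrying the generator \<open>q\<close> of \<open>Hom(P, Q)\<close> to the
    embedding of \<open>P\<close> into its copy into a map \<open>g\<close> that splits \<open>q\<close>.\<close>
  obtain g where g: "g \<in> lin_hom S Q copy_P"
    and gh: "\<forall>f\<in>lin_hom S P Q. ?h f = compose (carrier P) g f"
    using full[OF Q copy_P(1) h] by blast
  have "inv_into (carrier S) \<alpha> q = \<one>\<^bsub>S\<^esub>" using \<alpha>_inj by (simp add: q_def inv_into_f_f)
  then have split: "g (q p) = iP p" if "p \<in> carrier P" for p
    using fun_cong[OF bspec[OF gh q], of p] that q by (simp add: compose_def rsmult_one)
  have "compose (carrier P) q e \<in> \<alpha> ` carrier S"
    using lin_hom_compose[OF left_module_axioms e q] by (simp add: \<alpha>_im)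
  then obtain s where s: "s \<in> carrier S" "compose (carrier P) q e = \<alpha> s" by auto
  have scalar: "e p = rsmult P s p" if p: "p \<in> carrier P" for p
  proof -
    have "q (e p) = q (rsmult P s p)"
      using fun_cong[OF s(2), of p] p \<alpha>_eq[OF s(1) p] by (simp add: compose_def)
    then have "iP (e p) = iP (rsmult P s p)"
      using split[of "e p"] split[of "rsmult P s p"] lin_hom_closed[OF e p] rsmult_closed[OF s(1) p]
      by simp
    then show ?thesis using inj(2) by (simp add: inj_eq)
  qed
  have unique: "s = t" if t: "t \<in> carrier S"
    and eq: "\<And>p. p \<in> carrier P \<Longrightarrow> rsmult P s p = rsmult P t p" for t
  proof (rule inj_onD[OF \<alpha>_inj _ s(1) t])
    have "\<alpha> s \<in> lin_hom S P Q" "\<alpha> t \<in> lin_hom S P Q" using s(1) t \<alpha>_im by auto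
    then show "\<alpha> s = \<alpha> t"
      by (rule lin_hom_eqI) (simp add: \<alpha>_eq s(1) t eq)
  qed
  show ?thesis
  proof (rule ex1I)
    show "s \<in> carrier S \<and> (\<forall>p\<in>carrier P. e p = rsmult P s p)"
      using s(1) scalar by blast
    show "t = s" if "t \<in> carrier S \<and> (\<forall>p\<in>carrier P. e p = rsmult P t p)" for t
      using that scalar by (intro unique[symmetric]) auto
  qed
qed

lemma progenerator: "progenerator_bimodule S P"
  by unfold_locales (rule identity_finite_rank, rule one_in_trace, rule endomorphism_scalar)

end

theorem invertible_progenerator:
  fixes S :: "('s, 'm) ring_scheme" and P :: "('s, 's, 'p) bimodule"
  assumes "invertible_bimodule TYPE('k) S P"
  shows "progenerator_bimodule S P"
proof -
  let ?C = "module_cat S :: (('s, ('s, 'p, 'k) universe) module, _) cat"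
  let ?D = "module_cat S :: (('s, 'p \<Rightarrow> ('s, 'p, 'k) universe) module, _) cat"
  have bi: "bimodule S S P" and eq: "is_equivalence ?C ?D (hom_functor S P)"
    using assms unfolding invertible_bimodule_def by auto
  have F: "is_functor ?C ?D (hom_functor S P)" using eq unfolding is_equivalence_def by blast
  have simps: "obj (module_cat S) = {M. left_module S M}" "arr (module_cat S) = lin_hom S"
    "on_obj (hom_functor S P) = hom_left S P"
    "on_arr (hom_functor S P) = (\<lambda>M N f. \<lambda>h\<in>lin_hom S P M. compose (carrier P) f h)"
    by (auto simp: module_cat_def hom_functor_def)
  interpret hom_equivalence S P "\<lambda>s. {[Inl s]} :: ('s, 'p, 'k) universe" "\<lambda>p. {[Inr (Inl p)]}"
  proof (intro hom_equivalence.intro two_sided_module.intro hom_equivalence_axioms.intro)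
    show "bimodule S S P" by (rule bi)
  next
    fix M :: "('s, ('s, 'p, 'k) universe) module"
    assume "left_module S M" then show "left_module S (hom_left S P M)"
      using F unfolding is_functor_def simps by blast
  next
    fix M N :: "('s, ('s, 'p, 'k) universe) module" and f
    assume "left_module S M" "left_module S N" "f \<in> lin_hom S M N"
    then show "(\<lambda>h\<in>lin_hom S P M. compose (carrier P) f h) \<in> lin_hom S (hom_left S P M) (hom_left S P N)"
      using F unfolding is_functor_def simps by blast
  next
    fix M N :: "('s, ('s, 'p, 'k) universe) module" and f g
    assume "left_module S M" "left_module S N" "f \<in> lin_hom S M N" "g \<in> lin_hom S M N"
      and "\<And>h. h \<in> lin_hom S P M \<Longrightarrow> compose (carrier P) f h = compose (carrier P) g h"
    then show "f = g"
      using equivalence_faithful[OF module_category eq, of M N f g] by (simp add: simps cong: restrict_cong)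
  next
    fix M N :: "('s, ('s, 'p, 'k) universe) module" and h
    assume "left_module S M" "left_module S N" "h \<in> lin_hom S (hom_left S P M) (hom_left S P N)"
    then show "\<exists>f\<in>lin_hom S M N. \<forall>g\<in>lin_hom S P M. h g = compose (carrier P) f g"
      using equivalence_full[OF module_category module_category eq, of M N h] by (fastforce simp: simps)
  next
    fix Z :: "('s, 'p \<Rightarrow> ('s, 'p, 'k) universe) module"
    assume Z: "left_module S Z"
    then obtain M :: "('s, ('s, 'p, 'k) universe) module" and u where M: "left_module S M"
      and u: "is_iso ?D (hom_left S P M) Z u"
      using equivalence_essentially_surjective[OF eq, of Z] by (auto simp: simps)
    then obtain v where u: "u \<in> lin_hom S (hom_left S P M) Z" and v: "v \<in> lin_hom S Z (hom_left S P M)"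
      and vu: "compose (lin_hom S P M) v u = (\<lambda>x\<in>lin_hom S P M. x)"
      and uv: "compose (carrier Z) u v = (\<lambda>x\<in>carrier Z. x)"
      by (auto simp: is_iso_def module_cat_def)
    have "u (v z) = z" if "z \<in> carrier Z" for z
      using fun_cong[OF uv, of z] that by (simp add: compose_def)
    moreover have "v (u x) = x" if "x \<in> lin_hom S P M" for x
      using fun_cong[OF vu, of x] that by (simp add: compose_def)
    ultimately have "bij_betw v (carrier Z) (lin_hom S P M)"
      using lin_hom_closed[OF u] lin_hom_closed[OF v]
      by (intro bij_betw_byWitness[where f' = u]) auto
    with M v show "\<exists>M :: ('s, ('s, 'p, 'k) universe) module. left_module S M \<and>
        module_iso S Z (hom_left S P M) \<noteq> {}"
      by (auto simp: module_iso_def)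
  qed (auto simp: inj_def)
  show ?thesis by (rule progenerator)
qed


section \<open>Biduals with coefficients in a progenerator\<close>

lemma (in two_sided_module) lin_hom_rsmult:
  assumes "left_module S X" "f \<in> lin_hom S X B" "r \<in> carrier R"
  shows "(\<lambda>x\<in>carrier X. rsmult B r (f x)) \<in> lin_hom S X B"
  by (rule restrict_lin_hom[OF assms(1)])
    (use assms(2,3) in \<open>simp_all add: rsmult_closed lin_hom_closed lin_hom_add lin_hom_smult
      rsmult_r_distr rsmult_smult\<close>)

text \<open>The right \<open>S\<close>-linear functionals \<open>Hom\<^sub>S(X,P) \<rightarrow> P\<close>.\<close>

definition coeff_bidual ::
    "('s, 'k) ring_scheme \<Rightarrow> ('s, 's, 'p) bimodule \<Rightarrow> ('s, 'x, 'm) module_scheme \<Rightarrow>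
       (('x \<Rightarrow> 'p) \<Rightarrow> 'p) set" where
  "coeff_bidual S P X = lin_hom (opposite_ring S)
     (with_action (hom_group S X P) (\<lambda>s f. \<lambda>x\<in>carrier X. rsmult P s (f x))) (right_part P)"

lemma coeff_bidual_iff:
  "\<Phi> \<in> coeff_bidual S P X \<longleftrightarrow> \<Phi> \<in> lin_hom S X P \<rightarrow>\<^sub>E carrier P \<and>
    (\<forall>f\<in>lin_hom S X P. \<forall>g\<in>lin_hom S X P. \<Phi> (\<lambda>x\<in>carrier X. f x \<oplus>\<^bsub>P\<^esub> g x) = \<Phi> f \<oplus>\<^bsub>P\<^esub> \<Phi> g) \<and>
    (\<forall>s\<in>carrier S. \<forall>f\<in>lin_hom S X P. \<Phi> (\<lambda>x\<in>carrier X. rsmult P s (f x)) = rsmult P s (\<Phi> f))"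
  by (simp add: coeff_bidual_def with_action_def hom_group_def
      lin_hom_def[of "opposite_ring S"])

definition separated_by ::
    "('s, 'k) ring_scheme \<Rightarrow> ('s, 's, 'p) bimodule \<Rightarrow> ('s, 'x, 'm) module_scheme \<Rightarrow> bool" where
  "separated_by S P X \<longleftrightarrow>
     (\<forall>x\<in>carrier X. \<forall>y\<in>carrier X. (\<forall>f\<in>lin_hom S X P. f x = f y) \<longrightarrow> x = y)"

definition represents_bidual ::
    "('s, 'k) ring_scheme \<Rightarrow> ('s, 's, 'p) bimodule \<Rightarrow> ('s, 'x, 'm) module_scheme \<Rightarrow> bool" where
  "represents_bidual S P X \<longleftrightarrow>
     (\<forall>\<Phi>\<in>coeff_bidual S P X. \<exists>x\<in>carrier X. \<forall>f\<in>lin_hom S X P. \<Phi> f = f x)"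

text \<open>Taking \<open>P = S\<close> as a bimodule over itself recovers the ordinary bidual.\<close>

definition regular_bimodule :: "('s, 'k) ring_scheme \<Rightarrow> ('s, 's, 's) bimodule" where
  "regular_bimodule S = with_biaction S (mult S) (\<lambda>s x. x \<otimes>\<^bsub>S\<^esub> s)"

lemma regular_bimodule_simps [simp]:
  "carrier (regular_bimodule S) = carrier S" "add (regular_bimodule S) = add S"
  "zero (regular_bimodule S) = zero S" "smult (regular_bimodule S) = mult S"
  "rsmult (regular_bimodule S) = (\<lambda>s x. x \<otimes>\<^bsub>S\<^esub> s)"
  by (simp_all add: regular_bimodule_def with_biaction_def)

lemma regular_two_sided:
  assumes "ring S" shows "two_sided_module S S (regular_bimodule S)"
proof -
  interpret ring S by fact
  show ?thesis
  proof (unfold_locales, unfold bimodule_def, intro conjI ballI)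
    show "left_module S (regular_bimodule S)"
    proof (intro left_module.intro left_module_axioms.intro)
      show "abelian_group (regular_bimodule S)"
        by (rule abelian_group_cong[of S]) (simp_all add: abelian_group_axioms)
    qed (simp_all add: ring_axioms l_distr r_distr m_assoc)
    show "left_module (opposite_ring S) (right_part (regular_bimodule S))"
    proof (intro left_module.intro left_module_axioms.intro)
      show "abelian_group (right_part (regular_bimodule S))"
        by (rule abelian_group_cong[of S]) (simp_all add: abelian_group_axioms)
      have "abelian_group (opposite_ring S)"
        by (rule abelian_group_cong[of S]) (simp_all add: abelian_group_axioms)
      then show "ring (opposite_ring S)"
        by (rule ringI) (auto intro!: monoidI simp: l_distr r_distr m_assoc)
    qed (simp_all add: l_distr r_distr m_assoc)
  qed (simp_all add: m_assoc)
qed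

lemma lin_hom_regular_bimodule:
  "lin_hom S X (regular_bimodule S) = lin_hom S X (regular_module S)"
  by (simp add: lin_hom_def)

lemma carrier_dual: "carrier (dual S X) = lin_hom S X (regular_bimodule S)"
  by (simp add: dual_def with_action_def hom_group_def lin_hom_regular_bimodule)

lemma carrier_bidual: "carrier (bidual S X) = coeff_bidual S (regular_bimodule S) X"
  unfolding bidual_def
  by (simp add: dual_def[of "opposite_ring S"] with_action_def hom_group_def set_eq_iff
      coeff_bidual_iff lin_hom_def[of "opposite_ring S"] dual_def[of S]
      lin_hom_regular_bimodule)

lemma ev_lin_hom:
  assumes "left_module S X"
  shows "ev S X \<in> lin_hom S X (bidual S X)"
proof -
  interpret X: left_module S X by fact
  let ?D = "lin_hom S X (regular_bimodule S)"
  interpret B: two_sided_module S S "regular_bimodule S" by (rule regular_two_sided[OF X.R.ring_axioms])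
  have sum: "(\<lambda>x\<in>carrier X. f x \<oplus>\<^bsub>S\<^esub> g x) \<in> ?D" if "f \<in> ?D" "g \<in> ?D" for f g
    using lin_hom_sum[OF assms B.left_module_axioms that] by simp
  have scaled: "(\<lambda>x\<in>carrier X. f x \<otimes>\<^bsub>S\<^esub> s) \<in> ?D" if "f \<in> ?D" "s \<in> carrier S" for f s
    using B.lin_hom_rsmult[OF assms that] by simp
  have closed: "f x \<in> carrier S" if "f \<in> ?D" "x \<in> carrier X" for f x
    using lin_hom_closed[OF that] by simp
  have add: "(\<lambda>f\<in>?D. f (x \<oplus>\<^bsub>X\<^esub> y)) = (\<lambda>f\<in>?D. (\<lambda>f\<in>?D. f x) f \<oplus>\<^bsub>S\<^esub> (\<lambda>f\<in>?D. f y) f)"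
    if "x \<in> carrier X" "y \<in> carrier X" for x y
    by (rule restrict_ext) (use that in \<open>simp add: lin_hom_add\<close>)
  have smult: "(\<lambda>f\<in>?D. f (s \<odot>\<^bsub>X\<^esub> x)) = (\<lambda>f\<in>?D. s \<otimes>\<^bsub>S\<^esub> (\<lambda>f\<in>?D. f x) f)"
    if "s \<in> carrier S" "x \<in> carrier X" for s x
    by (rule restrict_ext) (use that in \<open>simp add: lin_hom_smult\<close>)
  have add_eq: "a \<oplus>\<^bsub>bidual S X\<^esub> b = (\<lambda>f\<in>?D. a f \<oplus>\<^bsub>S\<^esub> b f)" for a b
    by (simp add: bidual_def dual_def[of "opposite_ring S"] with_action_def hom_group_def carrier_dual)
  have smult_eq: "s \<odot>\<^bsub>bidual S X\<^esub> a = (\<lambda>f\<in>?D. s \<otimes>\<^bsub>S\<^esub> a f)" for s a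
    by (simp add: bidual_def dual_def[of "opposite_ring S"] with_action_def hom_group_def carrier_dual)
  show ?thesis
    unfolding ev_def carrier_dual
  proof (rule restrict_lin_hom[OF assms])
    fix x assume "x \<in> carrier X"
    then show "(\<lambda>f\<in>?D. f x) \<in> carrier (bidual S X)"
      by (simp add: carrier_bidual coeff_bidual_iff sum scaled closed)
  qed (simp_all only: add_eq smult_eq add smult)
qed

lemma torsionless_iff:
  assumes "left_module S X"
  shows "torsionless_module S X \<longleftrightarrow> separated_by S (regular_bimodule S) X"
proof -
  have "ev S X x = ev S X y \<longleftrightarrow> (\<forall>f\<in>lin_hom S X (regular_bimodule S). f x = f y)"
    if "x \<in> carrier X" "y \<in> carrier X" for x y
    using that by (auto simp: ev_def carrier_dual fun_eq_iff restrict_def)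
  then show ?thesis
    using ev_lin_hom[OF assms]
    by (auto simp: torsionless_module_def module_mono_def inj_on_def separated_by_def)
qed

lemma reflexive_iff:
  assumes "left_module S X"
  shows "reflexive_module S X \<longleftrightarrow>
    separated_by S (regular_bimodule S) X \<and> represents_bidual S (regular_bimodule S) X"
proof -
  let ?D = "lin_hom S X (regular_bimodule S)"
  have ev: "ev S X \<in> lin_hom S X (bidual S X)" by (rule ev_lin_hom[OF assms])
  have "\<Phi> = ev S X x \<longleftrightarrow> (\<forall>f\<in>?D. \<Phi> f = f x)"
    if "\<Phi> \<in> coeff_bidual S (regular_bimodule S) X" "x \<in> carrier X" for \<Phi> x
  proof -
    have "\<Phi> \<in> extensional ?D"
      using that(1) by (auto simp: coeff_bidual_iff PiE_def)
    then show ?thesis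
      using that(2) by (auto simp: ev_def carrier_dual extensional_def fun_eq_iff)
  qed
  note evaluation = this
  have "ev S X ` carrier X = carrier (bidual S X) \<longleftrightarrow>
      (\<forall>\<Phi>\<in>carrier (bidual S X). \<exists>x\<in>carrier X. \<Phi> = ev S X x)"
    using lin_hom_closed[OF ev] by (auto simp only: image_iff)
  also have "\<dots> \<longleftrightarrow> represents_bidual S (regular_bimodule S) X"
    by (simp add: carrier_bidual represents_bidual_def evaluation cong: ball_cong bex_cong)
  finally have "ev S X ` carrier X = carrier (bidual S X) \<longleftrightarrow>
    represents_bidual S (regular_bimodule S) X" .
  then show ?thesis
    using ev torsionless_iff[OF assms]
    by (auto simp: reflexive_module_def torsionless_module_def module_iso_def module_mono_def
        bij_betw_def)
qed

context progenerator_bimodule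
begin

lemma separated:
  assumes "p \<in> carrier P" "q \<in> carrier P"
    and eq: "\<And>y. y \<in> lin_hom S P (regular_module S) \<Longrightarrow> y p = y q"
  shows "p = q"
proof -
  have "e p = e q" if "e \<in> finite_rank S P P" for e
    using that
  proof induction
    case (rank_one y u)
    then show ?case using assms(1,2) eq[OF rank_one(1)] by simp
  qed (use assms(1,2) in simp)
  from this[OF identity_finite_rank] show ?thesis using assms by simp
qed

lemma trace_closed: "t \<in> trace S P (regular_module S) \<Longrightarrow> t \<in> carrier S"
  using submodule.sub[OF trace_submodule[OF left_module_axioms regular_left_module[OF R.ring_axioms]]]
  by auto

lemma faithful:
  assumes "a \<in> carrier S" "b \<in> carrier S" and eq: "\<And>p. p \<in> carrier P \<Longrightarrow> a \<odot>\<^bsub>P\<^esub> p = b \<odot>\<^bsub>P\<^esub> p"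
  shows "a = b"
proof -
  have "a \<otimes>\<^bsub>S\<^esub> t = b \<otimes>\<^bsub>S\<^esub> t" if "t \<in> trace S P (regular_module S)" for t
    using that
  proof induction
    case (trace_value f p)
    then show ?case
      using lin_hom_smult[OF trace_value(1) assms(1) trace_value(2)]
        lin_hom_smult[OF trace_value(1) assms(2) trace_value(2)] eq[OF trace_value(2)] by simp
  next
    case (trace_sum x y)
    then show ?case using assms(1,2) trace_closed by (simp add: R.r_distr)
  qed
  from this[OF one_in_trace] show ?thesis using assms(1,2) by simp
qed

text \<open>The composite \<open>p \<mapsto> y(p) u\<close> is a left endomorphism of \<open>P\<close>, hence right multiplication by a scalar.
  This is the pairing \<open>Hom\<^sub>S(P,S) \<times> P \<rightarrow> S\<close> of the Morita context, with \<open>p [y,u] = y(p) u\<close>; it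
  carries facts about \<open>P\<close> as a left module over to \<open>P\<close> as a right module.\<close>

definition bracket where
  "bracket y u = (THE s. s \<in> carrier S \<and> (\<forall>p\<in>carrier P. y p \<odot>\<^bsub>P\<^esub> u = rsmult P s p))"

lemma bracket_ex1:
  assumes "y \<in> lin_hom S P (regular_module S)" "u \<in> carrier P"
  shows "\<exists>!s. s \<in> carrier S \<and> (\<forall>p\<in>carrier P. y p \<odot>\<^bsub>P\<^esub> u = rsmult P s p)"
  using endomorphism_scalar[OF scalar_lin_hom[OF left_module_axioms left_module_axioms assms]]
  by simp

lemma bracket:
  assumes "y \<in> lin_hom S P (regular_module S)" "u \<in> carrier P"
  shows "bracket y u \<in> carrier S"
    and "p \<in> carrier P \<Longrightarrow> rsmult P (bracket y u) p = y p \<odot>\<^bsub>P\<^esub> u"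
  using theI'[OF bracket_ex1[OF assms]] unfolding bracket_def by auto

lemma bracket_eqI:
  assumes "y \<in> lin_hom S P (regular_module S)" "u \<in> carrier P" "s \<in> carrier S"
    and "\<And>p. p \<in> carrier P \<Longrightarrow> rsmult P s p = y p \<odot>\<^bsub>P\<^esub> u"
  shows "bracket y u = s"
  using bracket_ex1[OF assms(1,2)] bracket[OF assms(1,2)] assms(3,4) by metis

lemma bracket_add:
  assumes y: "y \<in> lin_hom S P (regular_module S)" and uv: "u \<in> carrier P" "v \<in> carrier P"
  shows "bracket y (u \<oplus>\<^bsub>P\<^esub> v) = bracket y u \<oplus>\<^bsub>S\<^esub> bracket y v"
  using lin_hom_closed[OF y] uv
  by (intro bracket_eqI[OF y]) (simp_all add: bracket[OF y] rsmult_l_distr smult_r_distr)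

lemma bracket_rsmult:
  assumes y: "y \<in> lin_hom S P (regular_module S)" and u: "u \<in> carrier P" and s: "s \<in> carrier S"
  shows "bracket y (rsmult P s u) = bracket y u \<otimes>\<^bsub>S\<^esub> s"
  using lin_hom_closed[OF y] u s
  by (intro bracket_eqI[OF y])
    (simp_all add: bracket[OF y] rsmult_closed rsmult_assoc rsmult_smult)

text \<open>On a value \<open>t = y(u)\<close> of the trace, \<open>d(y(u) p) = d(u [y,p]) = d(u) [y,p] = y(d(u)) p\<close>; the unit is a
  sum of such values.\<close>

lemma right_endomorphism:
  assumes closed: "\<And>p. p \<in> carrier P \<Longrightarrow> d p \<in> carrier P"
    and add: "\<And>p q. p \<in> carrier P \<Longrightarrow> q \<in> carrier P \<Longrightarrow> d (p \<oplus>\<^bsub>P\<^esub> q) = d p \<oplus>\<^bsub>P\<^esub> d q"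
    and rsmult: "\<And>s p. s \<in> carrier S \<Longrightarrow> p \<in> carrier P \<Longrightarrow> d (rsmult P s p) = rsmult P s (d p)"
  shows "\<exists>a\<in>carrier S. \<forall>p\<in>carrier P. d p = a \<odot>\<^bsub>P\<^esub> p"
proof -
  have "\<exists>a\<in>carrier S. \<forall>p\<in>carrier P. d (t \<odot>\<^bsub>P\<^esub> p) = a \<odot>\<^bsub>P\<^esub> p"
    if "t \<in> trace S P (regular_module S)" for t
    using that
  proof induction
    case (trace_value y u)
    have "u \<in> carrier P" by fact
    note y = trace_value(1)
    have yd: "y (d u) \<in> carrier S" using lin_hom_closed[OF y closed] \<open>u \<in> carrier P\<close> by simp
    have "d (y u \<odot>\<^bsub>P\<^esub> p) = y (d u) \<odot>\<^bsub>P\<^esub> p" if p: "p \<in> carrier P" for p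
      using bracket[OF y p] \<open>u \<in> carrier P\<close> rsmult[of "bracket y p" u] closed by metis
    with yd show ?case by blast
  next
    case (trace_sum x z)
    then obtain a b where a: "a \<in> carrier S" "b \<in> carrier S"
      "\<forall>p\<in>carrier P. d (x \<odot>\<^bsub>P\<^esub> p) = a \<odot>\<^bsub>P\<^esub> p" "\<forall>p\<in>carrier P. d (z \<odot>\<^bsub>P\<^esub> p) = b \<odot>\<^bsub>P\<^esub> p" by blast
    then have "\<forall>p\<in>carrier P. d ((x \<oplus>\<^bsub>S\<^esub> z) \<odot>\<^bsub>P\<^esub> p) = (a \<oplus>\<^bsub>S\<^esub> b) \<odot>\<^bsub>P\<^esub> p"
      using trace_sum(1,2) trace_closed by (simp add: smult_l_distr add smult_closed)
    then show ?case using a(1,2) by (intro bexI[of _ "a \<oplus>\<^bsub>S\<^esub> b"]) auto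
  qed
  from this[OF one_in_trace] show ?thesis by (auto simp: smult_one)
qed

text \<open>A functional on \<open>P\<close> turns maps into \<open>P\<close> into maps into \<open>S\<close>, and multiplication with an element of
  \<open>P\<close> goes back; \<open>separated\<close> and \<open>faithful\<close> ensure that no information is lost.\<close>

lemma separated_by_iff:
  assumes X: "left_module S X"
  shows "separated_by S (regular_bimodule S) X \<longleftrightarrow> separated_by S P X"
proof -
  have "(\<forall>f\<in>lin_hom S X (regular_module S). f x = f y) \<longleftrightarrow> (\<forall>f\<in>lin_hom S X P. f x = f y)"
    if xy: "x \<in> carrier X" "y \<in> carrier X" for x y
  proof (intro iffI ballI)
    fix f assume f: "f \<in> lin_hom S X P" and eq: "\<forall>g\<in>lin_hom S X (regular_module S). g x = g y"
    show "f x = f y"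
    proof (rule separated)
      fix h assume "h \<in> lin_hom S P (regular_module S)"
      from bspec[OF eq lin_hom_compose[OF X f this]] show "h (f x) = h (f y)"
        using xy by (simp add: compose_def)
    qed (use xy f in \<open>auto simp: lin_hom_closed\<close>)
  next
    fix g assume g: "g \<in> lin_hom S X (regular_module S)" and eq: "\<forall>f\<in>lin_hom S X P. f x = f y"
    show "g x = g y"
    proof (rule faithful)
      fix p assume "p \<in> carrier P"
      from bspec[OF eq scalar_lin_hom[OF X left_module_axioms g this]]
      show "g x \<odot>\<^bsub>P\<^esub> p = g y \<odot>\<^bsub>P\<^esub> p" using xy by simp
    qed (use lin_hom_closed[OF g] xy in auto)
  qed
  then show ?thesis by (simp add: separated_by_def lin_hom_regular_bimodule)
qed

lemma finite_rank_lin_hom: "e \<in> finite_rank S P P \<Longrightarrow> e \<in> lin_hom S P P"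
  by (induction rule: finite_rank.induct)
    (simp_all only: scalar_lin_hom[OF left_module_axioms left_module_axioms]
      lin_hom_sum[OF left_module_axioms left_module_axioms])

text \<open>A functional \<open>\<Phi>\<close> on \<open>Hom\<^sub>S(X,S)\<close> extends to maps \<open>f: X \<rightarrow> P\<close>: the value \<open>\<Psi>(f)\<close> is the only element of
  \<open>P\<close> with \<open>y(\<Psi>(f)) = \<Phi>(y \<circ> f)\<close> for all \<open>y: P \<rightarrow> S\<close>. With a dual basis it is \<open>\<Sum> \<Phi>(y\<^sub>i \<circ> f) p\<^sub>i\<close>.
  If \<open>\<Psi>\<close> is evaluation at \<open>x\<close>, then \<open>\<Phi>(g t) = g(x) t\<close> for each \<open>t\<close> in the trace of \<open>P\<close>, in particular
  for \<open>t = 1\<close>.\<close>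

lemma represents_bidual_regularI:
  assumes X: "left_module S X" and rep: "represents_bidual S P X"
  shows "represents_bidual S (regular_bimodule S) X"
  unfolding represents_bidual_def lin_hom_regular_bimodule
proof
  interpret Reg: two_sided_module S S "regular_bimodule S"
    by (rule regular_two_sided[OF R.ring_axioms])
  let ?G = "lin_hom S X (regular_module S)"
  let ?H = "lin_hom S X P"
  fix \<Phi> assume "\<Phi> \<in> coeff_bidual S (regular_bimodule S) X"
  then have \<Phi>: "\<And>g. g \<in> ?G \<Longrightarrow> \<Phi> g \<in> carrier S"
    and \<Phi>_add: "\<And>g h. g \<in> ?G \<Longrightarrow> h \<in> ?G \<Longrightarrow> \<Phi> (\<lambda>x\<in>carrier X. g x \<oplus>\<^bsub>S\<^esub> h x) = \<Phi> g \<oplus>\<^bsub>S\<^esub> \<Phi> h"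
    and \<Phi>_mult: "\<And>g s. g \<in> ?G \<Longrightarrow> s \<in> carrier S \<Longrightarrow> \<Phi> (\<lambda>x\<in>carrier X. g x \<otimes>\<^bsub>S\<^esub> s) = \<Phi> g \<otimes>\<^bsub>S\<^esub> s"
    by (auto simp: coeff_bidual_iff lin_hom_regular_bimodule)
  let ?P = "\<lambda>f q. q \<in> carrier P \<and>
    (\<forall>\<psi>\<in>lin_hom S P (regular_module S). \<psi> q = \<Phi> (\<lambda>x\<in>carrier X. \<psi> (f x)))"
  have comp: "(\<lambda>x\<in>carrier X. \<psi> (f x)) \<in> ?G"
    if "f \<in> ?H" "\<psi> \<in> lin_hom S P (regular_module S)" for f \<psi>
    using lin_hom_compose[OF X that] by (simp add: compose_def)
  have ex: "\<exists>q. ?P f q" if f: "f \<in> ?H" for f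
  proof -
    have "\<exists>q. q \<in> carrier P \<and>
        (\<forall>\<psi>\<in>lin_hom S P (regular_module S). \<psi> q = \<Phi> (\<lambda>x\<in>carrier X. \<psi> (e (f x))))"
      if "e \<in> finite_rank S P P" for e
      using that
    proof induction
      case (rank_one y p)
      let ?q = "\<Phi> (\<lambda>x\<in>carrier X. y (f x)) \<odot>\<^bsub>P\<^esub> p"
      have yf: "(\<lambda>x\<in>carrier X. y (f x)) \<in> ?G" by (rule comp[OF f rank_one(1)])
      have "\<psi> ?q = \<Phi> (\<lambda>x\<in>carrier X. \<psi> ((\<lambda>x\<in>carrier P. y x \<odot>\<^bsub>P\<^esub> p) (f x)))"
        if \<psi>: "\<psi> \<in> lin_hom S P (regular_module S)" for \<psi>
      proof -
        have "(\<lambda>x\<in>carrier X. \<psi> ((\<lambda>x\<in>carrier P. y x \<odot>\<^bsub>P\<^esub> p) (f x))) =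
          (\<lambda>x\<in>carrier X. (\<lambda>x\<in>carrier X. y (f x)) x \<otimes>\<^bsub>S\<^esub> \<psi> p)"
          using lin_hom_closed[OF f] lin_hom_closed[OF rank_one(1)] rank_one(2)
          by (intro restrict_ext) (simp add: lin_hom_smult[OF \<psi>])
        then show ?thesis
          using \<Phi>_mult[OF yf] \<Phi>[OF yf] lin_hom_closed[OF \<psi> rank_one(2)] rank_one(2)
          by (simp add: lin_hom_smult[OF \<psi>])
      qed
      moreover have "?q \<in> carrier P" using \<Phi>[OF yf] rank_one(2) by (simp add: smult_closed)
      ultimately show ?case by blast
    next
      case (rank_sum e e')
      then obtain q q' where q: "q \<in> carrier P" "q' \<in> carrier P"
        "\<forall>\<psi>\<in>lin_hom S P (regular_module S). \<psi> q = \<Phi> (\<lambda>x\<in>carrier X. \<psi> (e (f x)))"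
        "\<forall>\<psi>\<in>lin_hom S P (regular_module S). \<psi> q' = \<Phi> (\<lambda>x\<in>carrier X. \<psi> (e' (f x)))" by blast
      have lin: "(\<lambda>x\<in>carrier X. e (f x)) \<in> ?H" "(\<lambda>x\<in>carrier X. e' (f x)) \<in> ?H"
        using lin_hom_compose[OF X f finite_rank_lin_hom] rank_sum(1,2) by (simp_all add: compose_def)
      have "\<psi> (q \<oplus>\<^bsub>P\<^esub> q') = \<Phi> (\<lambda>x\<in>carrier X. \<psi> ((\<lambda>x\<in>carrier P. e x \<oplus>\<^bsub>P\<^esub> e' x) (f x)))"
        if \<psi>: "\<psi> \<in> lin_hom S P (regular_module S)" for \<psi>
      proof -
        have eq: "(\<lambda>x\<in>carrier X. \<psi> ((\<lambda>x\<in>carrier P. e x \<oplus>\<^bsub>P\<^esub> e' x) (f x))) =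
          (\<lambda>x\<in>carrier X. (\<lambda>x\<in>carrier X. \<psi> (e (f x))) x \<oplus>\<^bsub>S\<^esub> (\<lambda>x\<in>carrier X. \<psi> (e' (f x))) x)"
          using lin_hom_closed[OF f] lin_hom_closed[OF lin(1)] lin_hom_closed[OF lin(2)]
          by (intro restrict_ext) (simp add: lin_hom_add[OF \<psi>])
        have mem: "(\<lambda>x\<in>carrier X. \<psi> (e (f x))) \<in> ?G" "(\<lambda>x\<in>carrier X. \<psi> (e' (f x))) \<in> ?G"
          using comp[OF lin(1) \<psi>] comp[OF lin(2) \<psi>] by (simp_all cong: restrict_cong)
        show ?thesis
          unfolding eq \<Phi>_add[OF mem] using q \<psi> by (simp add: lin_hom_add[OF \<psi>])
      qed
      then show ?case using M.a_closed[OF q(1,2)] by blast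
    qed
    moreover have "(\<lambda>x\<in>carrier X. \<psi> ((\<lambda>p\<in>carrier P. p) (f x))) = (\<lambda>x\<in>carrier X. \<psi> (f x))" for \<psi> :: "_ \<Rightarrow> 'a"
      using lin_hom_closed[OF f] by (intro restrict_ext) simp
    ultimately show ?thesis using identity_finite_rank by metis
  qed
  define \<Psi> where "\<Psi> = (\<lambda>f\<in>?H. SOME q. ?P f q)"
  have \<Psi>: "?P f (\<Psi> f)" if "f \<in> ?H" for f
    unfolding \<Psi>_def restrict_apply'[OF that] by (rule someI_ex[OF ex[OF that]])
  have \<Psi>_closed: "\<Psi> f \<in> carrier P" if "f \<in> ?H" for f
    using \<Psi>[OF that] by blast
  have \<Psi>_eq: "y (\<Psi> f) = \<Phi> (\<lambda>x\<in>carrier X. y (f x))"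
    if "f \<in> ?H" "y \<in> lin_hom S P (regular_module S)" for f y
    using \<Psi>[OF that(1)] that(2) by blast
  have sumH: "(\<lambda>x\<in>carrier X. f x \<oplus>\<^bsub>P\<^esub> g x) \<in> ?H" if "f \<in> ?H" "g \<in> ?H" for f g
    by (rule lin_hom_sum[OF X left_module_axioms that])
  note scaleH = lin_hom_rsmult[OF X]
  have "\<Psi> \<in> coeff_bidual S P X"
    unfolding coeff_bidual_iff
  proof (intro conjI ballI)
    show "\<Psi> \<in> ?H \<rightarrow>\<^sub>E carrier P"
      using \<Psi>_closed by (auto simp: PiE_def \<Psi>_def)
  next
    fix f g assume fg: "f \<in> ?H" "g \<in> ?H"
    show "\<Psi> (\<lambda>x\<in>carrier X. f x \<oplus>\<^bsub>P\<^esub> g x) = \<Psi> f \<oplus>\<^bsub>P\<^esub> \<Psi> g"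
    proof (rule separated)
      fix y assume y: "y \<in> lin_hom S P (regular_module S)"
      have eq: "(\<lambda>x\<in>carrier X. y ((\<lambda>x\<in>carrier X. f x \<oplus>\<^bsub>P\<^esub> g x) x)) =
        (\<lambda>x\<in>carrier X. (\<lambda>x\<in>carrier X. y (f x)) x \<oplus>\<^bsub>S\<^esub> (\<lambda>x\<in>carrier X. y (g x)) x)"
        using lin_hom_closed[OF fg(1)] lin_hom_closed[OF fg(2)]
        by (intro restrict_ext) (simp add: lin_hom_add[OF y])
      show "y (\<Psi> (\<lambda>x\<in>carrier X. f x \<oplus>\<^bsub>P\<^esub> g x)) = y (\<Psi> f \<oplus>\<^bsub>P\<^esub> \<Psi> g)"
        unfolding \<Psi>_eq[OF sumH[OF fg] y] eq \<Phi>_add[OF comp[OF fg(1) y] comp[OF fg(2) y]]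
          lin_hom_add[OF y \<Psi>_closed[OF fg(1)] \<Psi>_closed[OF fg(2)]]
          \<Psi>_eq[OF fg(1) y] \<Psi>_eq[OF fg(2) y]
        by simp
    qed (use \<Psi>_closed fg sumH in auto)
  next
    fix s f assume s: "s \<in> carrier S" and f: "f \<in> ?H"
    show "\<Psi> (\<lambda>x\<in>carrier X. rsmult P s (f x)) = rsmult P s (\<Psi> f)"
    proof (rule separated)
      fix y assume y: "y \<in> lin_hom S P (regular_module S)"
      let ?y = "\<lambda>p\<in>carrier P. y (rsmult P s p)"
      have y': "?y \<in> lin_hom S P (regular_module S)"
        by (rule restrict_lin_hom[OF left_module_axioms])
          (use lin_hom_closed[OF y] s in \<open>simp_all add: rsmult_closed rsmult_r_distr rsmult_smult
            lin_hom_add[OF y] lin_hom_smult[OF y]\<close>)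
      have eq: "(\<lambda>x\<in>carrier X. y ((\<lambda>x\<in>carrier X. rsmult P s (f x)) x)) = (\<lambda>x\<in>carrier X. ?y (f x))"
        using lin_hom_closed[OF f] by (intro restrict_ext) simp
      show "y (\<Psi> (\<lambda>x\<in>carrier X. rsmult P s (f x))) = y (rsmult P s (\<Psi> f))"
        unfolding \<Psi>_eq[OF scaleH[OF f s] y] eq \<Psi>_eq[OF f y', symmetric]
        using \<Psi>_closed[OF f] by simp
    qed (use \<Psi>_closed[OF f] \<Psi>_closed[OF scaleH[OF f s]] s in \<open>auto simp: rsmult_closed\<close>)
  qed
  then obtain x where x: "x \<in> carrier X" and \<Psi>x: "\<And>f. f \<in> ?H \<Longrightarrow> \<Psi> f = f x"
    using rep unfolding represents_bidual_def by blast
  have "\<Phi> g = g x" if g: "g \<in> ?G" for g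
  proof -
    note gc = lin_hom_closed[OF g, simplified]
    have scaled: "(\<lambda>z\<in>carrier X. g z \<otimes>\<^bsub>S\<^esub> t) \<in> ?G" if "t \<in> carrier S" for t
      using Reg.lin_hom_rsmult[OF X, of g t] g that by (simp add: lin_hom_regular_bimodule)
    have "\<Phi> (\<lambda>z\<in>carrier X. g z \<otimes>\<^bsub>S\<^esub> t) = g x \<otimes>\<^bsub>S\<^esub> t"
      if "t \<in> trace S P (regular_module S)" for t
      using that
    proof induction
      case (trace_value y u)
      let ?f = "\<lambda>z\<in>carrier X. g z \<odot>\<^bsub>P\<^esub> u"
      have f: "?f \<in> ?H" by (rule scalar_lin_hom[OF X left_module_axioms g trace_value(2)])
      have eq: "(\<lambda>z\<in>carrier X. g z \<otimes>\<^bsub>S\<^esub> y u) = (\<lambda>z\<in>carrier X. y (?f z))"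
        using gc trace_value(2) by (intro restrict_ext) (simp add: lin_hom_smult[OF trace_value(1)])
      show ?case
        unfolding eq \<Psi>_eq[OF f trace_value(1), symmetric] \<Psi>x[OF f]
        using x gc[OF x] trace_value(2) by (simp add: lin_hom_smult[OF trace_value(1)])
    next
      case (trace_sum s t)
      then have st: "s \<in> carrier S" "t \<in> carrier S" by (auto simp: trace_closed)
      have eq: "(\<lambda>z\<in>carrier X. g z \<otimes>\<^bsub>S\<^esub> (s \<oplus>\<^bsub>S\<^esub> t)) = (\<lambda>z\<in>carrier X.
          (\<lambda>z\<in>carrier X. g z \<otimes>\<^bsub>S\<^esub> s) z \<oplus>\<^bsub>S\<^esub> (\<lambda>z\<in>carrier X. g z \<otimes>\<^bsub>S\<^esub> t) z)"
        using gc st by (intro restrict_ext) (simp add: R.r_distr)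
      show ?case
        unfolding regular_module_simps eq \<Phi>_add[OF scaled[OF st(1)] scaled[OF st(2)]] trace_sum(3,4)
        using gc[OF x] st by (simp add: R.r_distr)
    qed
    from this[OF one_in_trace] have "\<Phi> (\<lambda>z\<in>carrier X. g z \<otimes>\<^bsub>S\<^esub> \<one>\<^bsub>S\<^esub>) = g x"
      unfolding R.r_one[OF gc[OF x]] .
    moreover have "(\<lambda>z\<in>carrier X. g z \<otimes>\<^bsub>S\<^esub> \<one>\<^bsub>S\<^esub>) = (\<lambda>z\<in>carrier X. g z)"
      using gc by (intro restrict_ext) simp
    ultimately show ?thesis by (simp only: lin_hom_restrict_id[OF g])
  qed
  with x show "\<exists>x\<in>carrier X. \<forall>g\<in>?G. \<Phi> g = g x" by blast
qed

text \<open>For fixed \<open>g: X \<rightarrow> S\<close>, the value of \<open>\<Psi>\<close> at \<open>x \<mapsto> g(x) p\<close> is right linear in \<open>p\<close>, hence of the form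
  \<open>\<Phi>(g) p\<close>. If the functional \<open>\<Phi>\<close> obtained in this way is evaluation at \<open>x\<close>, then \<open>\<Psi>\<close> and the
  evaluation at \<open>x\<close> agree on the maps \<open>e \<circ> f\<close> with \<open>e\<close> of finite rank, in particular for \<open>e = 1\<close>.\<close>

lemma represents_bidual_coeffI:
  assumes X: "left_module S X" and rep: "represents_bidual S (regular_bimodule S) X"
  shows "represents_bidual S P X"
  unfolding represents_bidual_def
proof
  interpret Reg: two_sided_module S S "regular_bimodule S"
    by (rule regular_two_sided[OF R.ring_axioms])
  let ?G = "lin_hom S X (regular_module S)"
  let ?H = "lin_hom S X P"
  fix \<Psi> assume "\<Psi> \<in> coeff_bidual S P X"
  then have \<Psi>: "\<And>f. f \<in> ?H \<Longrightarrow> \<Psi> f \<in> carrier P"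
    and \<Psi>_add: "\<And>f g. f \<in> ?H \<Longrightarrow> g \<in> ?H \<Longrightarrow> \<Psi> (\<lambda>x\<in>carrier X. f x \<oplus>\<^bsub>P\<^esub> g x) = \<Psi> f \<oplus>\<^bsub>P\<^esub> \<Psi> g"
    and \<Psi>_rsmult: "\<And>f s. f \<in> ?H \<Longrightarrow> s \<in> carrier S \<Longrightarrow>
      \<Psi> (\<lambda>x\<in>carrier X. rsmult P s (f x)) = rsmult P s (\<Psi> f)"
    by (auto simp: coeff_bidual_iff)
  let ?P = "\<lambda>g a. a \<in> carrier S \<and> (\<forall>p\<in>carrier P. \<Psi> (\<lambda>x\<in>carrier X. g x \<odot>\<^bsub>P\<^esub> p) = a \<odot>\<^bsub>P\<^esub> p)"
  note scalar = scalar_lin_hom[OF X left_module_axioms]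
  have ex: "\<exists>a. ?P g a" if g: "g \<in> ?G" for g
  proof -
    note gc = lin_hom_closed[OF g, simplified]
    have "\<exists>a\<in>carrier S. \<forall>p\<in>carrier P. \<Psi> (\<lambda>x\<in>carrier X. g x \<odot>\<^bsub>P\<^esub> p) = a \<odot>\<^bsub>P\<^esub> p"
    proof (rule right_endomorphism)
      fix p assume "p \<in> carrier P"
      then show "\<Psi> (\<lambda>x\<in>carrier X. g x \<odot>\<^bsub>P\<^esub> p) \<in> carrier P"
        by (intro \<Psi> scalar[OF g])
    next
      fix p q assume pq: "p \<in> carrier P" "q \<in> carrier P"
      have "(\<lambda>x\<in>carrier X. g x \<odot>\<^bsub>P\<^esub> (p \<oplus>\<^bsub>P\<^esub> q)) = (\<lambda>x\<in>carrier X.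
          (\<lambda>x\<in>carrier X. g x \<odot>\<^bsub>P\<^esub> p) x \<oplus>\<^bsub>P\<^esub> (\<lambda>x\<in>carrier X. g x \<odot>\<^bsub>P\<^esub> q) x)"
        using gc pq by (intro restrict_ext) (simp add: smult_r_distr)
      then show "\<Psi> (\<lambda>x\<in>carrier X. g x \<odot>\<^bsub>P\<^esub> (p \<oplus>\<^bsub>P\<^esub> q)) =
          \<Psi> (\<lambda>x\<in>carrier X. g x \<odot>\<^bsub>P\<^esub> p) \<oplus>\<^bsub>P\<^esub> \<Psi> (\<lambda>x\<in>carrier X. g x \<odot>\<^bsub>P\<^esub> q)"
        by (simp only: \<Psi>_add[OF scalar[OF g pq(1)] scalar[OF g pq(2)]])
    next
      fix s p assume s: "s \<in> carrier S" and p: "p \<in> carrier P"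
      have "(\<lambda>x\<in>carrier X. g x \<odot>\<^bsub>P\<^esub> rsmult P s p) =
          (\<lambda>x\<in>carrier X. rsmult P s ((\<lambda>x\<in>carrier X. g x \<odot>\<^bsub>P\<^esub> p) x))"
        using gc p s by (intro restrict_ext) (simp add: rsmult_smult)
      then show "\<Psi> (\<lambda>x\<in>carrier X. g x \<odot>\<^bsub>P\<^esub> rsmult P s p) =
          rsmult P s (\<Psi> (\<lambda>x\<in>carrier X. g x \<odot>\<^bsub>P\<^esub> p))"
        by (simp only: \<Psi>_rsmult[OF scalar[OF g p] s])
    qed
    then show ?thesis by blast
  qed
  define \<Phi> where "\<Phi> = (\<lambda>g\<in>?G. SOME a. ?P g a)"
  have \<Phi>: "?P g (\<Phi> g)" if "g \<in> ?G" for g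
    unfolding \<Phi>_def restrict_apply'[OF that] by (rule someI_ex[OF ex[OF that]])
  have \<Phi>_closed: "\<Phi> g \<in> carrier S" if "g \<in> ?G" for g
    using \<Phi>[OF that] by blast
  have \<Phi>_eq: "\<Phi> g \<odot>\<^bsub>P\<^esub> p = \<Psi> (\<lambda>x\<in>carrier X. g x \<odot>\<^bsub>P\<^esub> p)"
    if "g \<in> ?G" "p \<in> carrier P" for g p
    using \<Phi>[OF that(1)] that(2) by simp
  have sumG: "(\<lambda>x\<in>carrier X. g x \<oplus>\<^bsub>S\<^esub> h x) \<in> ?G" if "g \<in> ?G" "h \<in> ?G" for g h
    using lin_hom_sum[OF X regular_left_module[OF R.ring_axioms] that] by simp
  have scaleG: "(\<lambda>x\<in>carrier X. g x \<otimes>\<^bsub>S\<^esub> s) \<in> ?G" if "g \<in> ?G" "s \<in> carrier S" for g s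
    using Reg.lin_hom_rsmult[OF X, of g s] that by (simp add: lin_hom_regular_bimodule)
  have "\<Phi> \<in> coeff_bidual S (regular_bimodule S) X"
    unfolding coeff_bidual_iff lin_hom_regular_bimodule regular_bimodule_simps
  proof (intro conjI ballI)
    show "\<Phi> \<in> ?G \<rightarrow>\<^sub>E carrier S"
      using \<Phi>_closed by (auto simp: PiE_def \<Phi>_def)
  next
    fix g h assume gh: "g \<in> ?G" "h \<in> ?G"
    note gc = lin_hom_closed[OF gh(1), simplified] lin_hom_closed[OF gh(2), simplified]
    show "\<Phi> (\<lambda>x\<in>carrier X. g x \<oplus>\<^bsub>S\<^esub> h x) = \<Phi> g \<oplus>\<^bsub>S\<^esub> \<Phi> h"
    proof (rule faithful)
      fix p assume p: "p \<in> carrier P"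
      have eq: "(\<lambda>x\<in>carrier X. (\<lambda>x\<in>carrier X. g x \<oplus>\<^bsub>S\<^esub> h x) x \<odot>\<^bsub>P\<^esub> p) = (\<lambda>x\<in>carrier X.
          (\<lambda>x\<in>carrier X. g x \<odot>\<^bsub>P\<^esub> p) x \<oplus>\<^bsub>P\<^esub> (\<lambda>x\<in>carrier X. h x \<odot>\<^bsub>P\<^esub> p) x)"
        using gc p by (intro restrict_ext) (simp add: smult_l_distr)
      show "\<Phi> (\<lambda>x\<in>carrier X. g x \<oplus>\<^bsub>S\<^esub> h x) \<odot>\<^bsub>P\<^esub> p = (\<Phi> g \<oplus>\<^bsub>S\<^esub> \<Phi> h) \<odot>\<^bsub>P\<^esub> p"
        unfolding \<Phi>_eq[OF sumG[OF gh] p] eq \<Psi>_add[OF scalar[OF gh(1) p] scalar[OF gh(2) p]]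
          smult_l_distr[OF \<Phi>_closed[OF gh(1)] \<Phi>_closed[OF gh(2)] p]
          \<Phi>_eq[OF gh(1) p] \<Phi>_eq[OF gh(2) p] ..
    qed (use \<Phi>_closed gh sumG in auto)
  next
    fix s g assume s: "s \<in> carrier S" and g: "g \<in> ?G"
    note gc = lin_hom_closed[OF g, simplified]
    show "\<Phi> (\<lambda>x\<in>carrier X. g x \<otimes>\<^bsub>S\<^esub> s) = \<Phi> g \<otimes>\<^bsub>S\<^esub> s"
    proof (rule faithful)
      fix p assume p: "p \<in> carrier P"
      have eq: "(\<lambda>x\<in>carrier X. (\<lambda>x\<in>carrier X. g x \<otimes>\<^bsub>S\<^esub> s) x \<odot>\<^bsub>P\<^esub> p) =
          (\<lambda>x\<in>carrier X. g x \<odot>\<^bsub>P\<^esub> (s \<odot>\<^bsub>P\<^esub> p))"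
        using gc p s by (intro restrict_ext) (simp add: smult_assoc)
      show "\<Phi> (\<lambda>x\<in>carrier X. g x \<otimes>\<^bsub>S\<^esub> s) \<odot>\<^bsub>P\<^esub> p = (\<Phi> g \<otimes>\<^bsub>S\<^esub> s) \<odot>\<^bsub>P\<^esub> p"
        unfolding \<Phi>_eq[OF scaleG[OF g s] p] eq smult_assoc[OF \<Phi>_closed[OF g] s p]
          \<Phi>_eq[OF g smult_closed[OF s p]] ..
    qed (use \<Phi>_closed[OF g] \<Phi>_closed[OF scaleG[OF g s]] s in auto)
  qed
  then obtain x where x: "x \<in> carrier X" and \<Phi>x: "\<And>g. g \<in> ?G \<Longrightarrow> \<Phi> g = g x"
    using rep unfolding represents_bidual_def lin_hom_regular_bimodule by blast
  have "\<Psi> f = f x" if f: "f \<in> ?H" for f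
  proof -
    note fc = lin_hom_closed[OF f]
    have "\<Psi> (\<lambda>z\<in>carrier X. e (f z)) = e (f x)" if "e \<in> finite_rank S P P" for e
      using that
    proof induction
      case (rank_one y p)
      have yf: "compose (carrier X) y f \<in> ?G" by (rule lin_hom_compose[OF X f rank_one(1)])
      have eq: "(\<lambda>z\<in>carrier X. (\<lambda>p'\<in>carrier P. y p' \<odot>\<^bsub>P\<^esub> p) (f z)) =
          (\<lambda>z\<in>carrier X. compose (carrier X) y f z \<odot>\<^bsub>P\<^esub> p)"
        using fc by (intro restrict_ext) (simp add: compose_def)
      show ?case
        unfolding eq \<Phi>_eq[OF yf rank_one(2), symmetric] \<Phi>x[OF yf]
        using fc[OF x] x by (simp add: compose_def)
    next
      case (rank_sum e e')
      have lin: "(\<lambda>z\<in>carrier X. e (f z)) \<in> ?H" "(\<lambda>z\<in>carrier X. e' (f z)) \<in> ?H"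
        using lin_hom_compose[OF X f finite_rank_lin_hom] rank_sum(1,2) by (simp_all add: compose_def)
      have eq: "(\<lambda>z\<in>carrier X. (\<lambda>p\<in>carrier P. e p \<oplus>\<^bsub>P\<^esub> e' p) (f z)) = (\<lambda>z\<in>carrier X.
          (\<lambda>z\<in>carrier X. e (f z)) z \<oplus>\<^bsub>P\<^esub> (\<lambda>z\<in>carrier X. e' (f z)) z)"
        using fc by (intro restrict_ext) simp
      show ?case
        unfolding eq \<Psi>_add[OF lin] rank_sum(3,4) using fc[OF x] by simp
    qed
    from this[OF identity_finite_rank]
    have "\<Psi> (\<lambda>z\<in>carrier X. (\<lambda>p\<in>carrier P. p) (f z)) = f x"
      unfolding restrict_apply'[OF fc[OF x]] .
    moreover have "(\<lambda>z\<in>carrier X. (\<lambda>p\<in>carrier P. p) (f z)) = (\<lambda>z\<in>carrier X. f z)"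
      using fc by (intro restrict_ext) simp
    ultimately show ?thesis by (simp only: lin_hom_restrict_id[OF f])
  qed
  with x show "\<exists>x\<in>carrier X. \<forall>f\<in>?H. \<Psi> f = f x" by blast
qed

end

theorem (in progenerator_bimodule) torsionless_iff_coeff:
  "left_module S X \<Longrightarrow> torsionless_module S X \<longleftrightarrow> separated_by S P X"
  by (simp add: torsionless_iff separated_by_iff)

theorem (in progenerator_bimodule) reflexive_iff_coeff:
  "left_module S X \<Longrightarrow> reflexive_module S X \<longleftrightarrow> separated_by S P X \<and> represents_bidual S P X"
  using reflexive_iff separated_by_iff represents_bidual_coeffI represents_bidual_regularI by blast


section \<open>Reflexive extensions\<close>

lemma restrict_scalars_simps [simp]:
  "carrier (restrict_scalars \<theta> X) = carrier X" "add (restrict_scalars \<theta> X) = add X"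
  "zero (restrict_scalars \<theta> X) = zero X" "smult (restrict_scalars \<theta> X) = (\<lambda>s. smult X (\<theta> s))"
  by (simp_all add: restrict_scalars_def with_action_def)

lemma extension_bimodule_simps [simp]:
  "carrier (extension_bimodule R \<theta>) = carrier R" "add (extension_bimodule R \<theta>) = add R"
  "smult (extension_bimodule R \<theta>) = (\<lambda>s x. \<theta> s \<otimes>\<^bsub>R\<^esub> x)"
  "rsmult (extension_bimodule R \<theta>) = (\<lambda>r x. x \<otimes>\<^bsub>R\<^esub> r)"
  by (simp_all add: extension_bimodule_def with_biaction_def)

lemma hom_bimodule_simps [simp]:
  "carrier (hom_bimodule S X Y) = lin_hom S X Y"
  "add (hom_bimodule S X Y) = (\<lambda>f g. \<lambda>x\<in>carrier X. f x \<oplus>\<^bsub>Y\<^esub> g x)"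
  "smult (hom_bimodule S X Y) = (\<lambda>r f. \<lambda>x\<in>carrier X. f (rsmult X r x))"
  "rsmult (hom_bimodule S X Y) = (\<lambda>t f. \<lambda>x\<in>carrier X. rsmult Y t (f x))"
  by (simp_all add: hom_bimodule_def with_biaction_def hom_group_def)

lemma restrict_right_simps [simp]:
  "carrier (restrict_right \<theta> W) = carrier W" "add (restrict_right \<theta> W) = add W"
  "smult (restrict_right \<theta> W) = smult W" "rsmult (restrict_right \<theta> W) = (\<lambda>s. rsmult W (\<theta> s))"
  by (simp_all add: restrict_right_def with_biaction_def)

lemma lin_hom_extension_bimodule:
  "lin_hom S (extension_bimodule R \<theta>) P = lin_hom S (restrict_scalars \<theta> (regular_module R)) P"
  by (simp add: lin_hom_def)

lemma restrict_scalars_left_module: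
  assumes "ring S" "\<theta> \<in> ring_hom S R" "left_module R X"
  shows "left_module S (restrict_scalars \<theta> X)"
proof -
  interpret X: left_module R X by fact
  show ?thesis
  proof (intro left_module.intro left_module_axioms.intro)
    show "abelian_group (restrict_scalars \<theta> X)"
      by (rule abelian_group_cong[of X]) (simp_all add: X.M.abelian_group_axioms)
  qed (use assms(1,2) in \<open>simp_all add: ring_hom_closed ring_hom_mult ring_hom_add ring_hom_one
    X.smult_closed X.smult_l_distr X.smult_r_distr X.smult_assoc X.smult_one\<close>)
qed

locale reflexive_extension = P: progenerator_bimodule S P + W: progenerator_bimodule R W
  for S :: "('s, 'm) ring_scheme" and R :: "('r, 'n) ring_scheme"
    and P :: "('s, 's, 'p) bimodule" and W :: "('r, 'r, 'w) bimodule" +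
  fixes \<theta> :: "'s \<Rightarrow> 'r" and \<sigma> :: "('r \<Rightarrow> 'p) \<Rightarrow> 'w"
  assumes hom: "\<theta> \<in> ring_hom S R"
    and iso: "\<sigma> \<in> bimodule_iso R S (hom_bimodule S (extension_bimodule R \<theta>) P) (restrict_right \<theta> W)"
    and reflexive: "reflexive_module S (restrict_scalars \<theta> (regular_module R))"
begin

abbreviation "E \<equiv> restrict_scalars \<theta> (regular_module R)"
abbreviation "H \<equiv> lin_hom S E P"

lemma theta_closed: "s \<in> carrier S \<Longrightarrow> \<theta> s \<in> carrier R"
  using ring_hom_closed[OF hom] .

lemma restrict_module: "left_module R X \<Longrightarrow> left_module S (restrict_scalars \<theta> X)"
  by (rule restrict_scalars_left_module[OF P.R.ring_axioms hom])

lemma E_module: "left_module S E"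
  by (rule restrict_module[OF regular_left_module[OF W.R.ring_axioms]])

lemma sigma_bij: "bij_betw \<sigma> H (carrier W)"
  using iso by (simp add: bimodule_iso_def module_iso_def lin_hom_extension_bimodule)

lemma sigma_add: "f \<in> H \<Longrightarrow> g \<in> H \<Longrightarrow> \<sigma> (\<lambda>r\<in>carrier R. f r \<oplus>\<^bsub>P\<^esub> g r) = \<sigma> f \<oplus>\<^bsub>W\<^esub> \<sigma> g"
  using iso lin_hom_add[of \<sigma> R "hom_bimodule S (extension_bimodule R \<theta>) P" "restrict_right \<theta> W" f g]
  by (simp add: bimodule_iso_def module_iso_def lin_hom_extension_bimodule)

lemma sigma_smult:
  "f \<in> H \<Longrightarrow> a \<in> carrier R \<Longrightarrow> \<sigma> (\<lambda>r\<in>carrier R. f (r \<otimes>\<^bsub>R\<^esub> a)) = a \<odot>\<^bsub>W\<^esub> \<sigma> f"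
  using iso lin_hom_smult[of \<sigma> R "hom_bimodule S (extension_bimodule R \<theta>) P" "restrict_right \<theta> W" a f]
  by (simp add: bimodule_iso_def module_iso_def lin_hom_extension_bimodule)

lemma sigma_rsmult:
  "f \<in> H \<Longrightarrow> s \<in> carrier S \<Longrightarrow> \<sigma> (\<lambda>r\<in>carrier R. rsmult P s (f r)) = rsmult W (\<theta> s) (\<sigma> f)"
  using iso lin_hom_smult[of \<sigma> "opposite_ring S" "right_part (hom_bimodule S (extension_bimodule R \<theta>) P)"
      "right_part (restrict_right \<theta> W)" s f]
  by (simp add: bimodule_iso_def module_iso_def lin_hom_extension_bimodule)

definition "\<rho> = inv_into H \<sigma>"

lemma rho_closed: "w \<in> carrier W \<Longrightarrow> \<rho> w \<in> H"
  unfolding \<rho>_def using bij_betw_imp_surj_on[OF sigma_bij] by (auto intro: inv_into_into)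

lemma sigma_rho: "w \<in> carrier W \<Longrightarrow> \<sigma> (\<rho> w) = w"
  unfolding \<rho>_def by (rule bij_betw_inv_into_right[OF sigma_bij])

lemma rho_sigma: "f \<in> H \<Longrightarrow> \<rho> (\<sigma> f) = f"
  unfolding \<rho>_def by (rule bij_betw_inv_into_left[OF sigma_bij])

lemma sigma_closed: "f \<in> H \<Longrightarrow> \<sigma> f \<in> carrier W"
  using sigma_bij by (auto simp: bij_betw_def)

text \<open>Transported along \<open>\<sigma>\<close>, the map \<open>\<tau>\<close> is evaluation at the unit of \<open>R\<close>, the counit of the adjunction
  between restriction of scalars and \<open>Hom\<^sub>S(R,-)\<close>.\<close>

definition "\<tau> w = \<rho> w \<one>\<^bsub>R\<^esub>"

lemma tau_closed: "w \<in> carrier W \<Longrightarrow> \<tau> w \<in> carrier P"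
  using lin_hom_closed[OF rho_closed] by (simp add: \<tau>_def)

lemma H_sum: "f \<in> H \<Longrightarrow> g \<in> H \<Longrightarrow> (\<lambda>r\<in>carrier R. f r \<oplus>\<^bsub>P\<^esub> g r) \<in> H"
  using lin_hom_sum[OF E_module P.left_module_axioms] by simp

lemma H_shift:
  assumes f: "f \<in> H" and a: "a \<in> carrier R"
  shows "(\<lambda>r\<in>carrier R. f (r \<otimes>\<^bsub>R\<^esub> a)) \<in> H"
proof -
  have "(\<lambda>r\<in>carrier E. f (r \<otimes>\<^bsub>R\<^esub> a)) \<in> H"
    by (rule restrict_lin_hom[OF E_module])
      (use a lin_hom_closed[OF f] lin_hom_add[OF f] lin_hom_smult[OF f] in
        \<open>simp_all add: W.R.l_distr W.R.m_assoc theta_closed\<close>)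
  then show ?thesis by simp
qed

lemma H_rsmult: "f \<in> H \<Longrightarrow> s \<in> carrier S \<Longrightarrow> (\<lambda>r\<in>carrier R. rsmult P s (f r)) \<in> H"
  using P.lin_hom_rsmult[OF E_module] by simp

lemma rho_smult:
  "w \<in> carrier W \<Longrightarrow> a \<in> carrier R \<Longrightarrow> \<rho> (a \<odot>\<^bsub>W\<^esub> w) = (\<lambda>r\<in>carrier R. \<rho> w (r \<otimes>\<^bsub>R\<^esub> a))"
  using rho_sigma[OF H_shift[OF rho_closed]] sigma_smult[OF rho_closed] by (simp add: sigma_rho)

lemma rho_tau: "w \<in> carrier W \<Longrightarrow> r \<in> carrier R \<Longrightarrow> \<rho> w r = \<tau> (r \<odot>\<^bsub>W\<^esub> w)"
  by (simp add: \<tau>_def rho_smult)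

lemma tau_add: "w \<in> carrier W \<Longrightarrow> w' \<in> carrier W \<Longrightarrow> \<tau> (w \<oplus>\<^bsub>W\<^esub> w') = \<tau> w \<oplus>\<^bsub>P\<^esub> \<tau> w'"
  using rho_sigma[OF H_sum[OF rho_closed rho_closed], of w w'] sigma_add[OF rho_closed rho_closed, of w w']
  by (simp add: sigma_rho \<tau>_def)

lemma tau_smult: "s \<in> carrier S \<Longrightarrow> w \<in> carrier W \<Longrightarrow> \<tau> (\<theta> s \<odot>\<^bsub>W\<^esub> w) = s \<odot>\<^bsub>P\<^esub> \<tau> w"
  using lin_hom_smult[OF rho_closed, of w s "\<one>\<^bsub>R\<^esub>"]
  by (simp add: theta_closed \<tau>_def rho_smult)

lemma tau_rsmult: "s \<in> carrier S \<Longrightarrow> w \<in> carrier W \<Longrightarrow> \<tau> (rsmult W (\<theta> s) w) = rsmult P s (\<tau> w)"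
  using rho_sigma[OF H_rsmult[OF rho_closed], of w s] sigma_rsmult[OF rho_closed, of w s]
  by (simp add: sigma_rho \<tau>_def)

lemma left_separation:
  assumes "w \<in> carrier W" "w' \<in> carrier W"
    and "\<And>r. r \<in> carrier R \<Longrightarrow> \<tau> (r \<odot>\<^bsub>W\<^esub> w) = \<tau> (r \<odot>\<^bsub>W\<^esub> w')"
  shows "w = w'"
proof -
  have "\<rho> w = \<rho> w'"
    by (rule lin_hom_eqI[OF rho_closed rho_closed]) (use assms in \<open>simp_all add: rho_tau\<close>)
  then show ?thesis using sigma_rho assms(1,2) by metis
qed

lemma tau_compose:
  assumes X: "left_module R X" and g: "g \<in> lin_hom R X W"
  shows "(\<lambda>x\<in>carrier X. \<tau> (g x)) \<in> lin_hom S (restrict_scalars \<theta> X) P"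
proof -
  have "(\<lambda>x\<in>carrier (restrict_scalars \<theta> X). \<tau> (g x)) \<in> lin_hom S (restrict_scalars \<theta> X) P"
    by (rule restrict_lin_hom[OF restrict_module[OF X]])
      (use lin_hom_closed[OF g] in \<open>simp_all add: tau_closed lin_hom_add[OF g] lin_hom_smult[OF g]
        tau_add tau_smult theta_closed\<close>)
  then show ?thesis by simp
qed

text \<open>The lift sends \<open>x\<close> to the element of \<open>W\<close> that corresponds to the map \<open>r \<mapsto> f(r x)\<close>.\<close>

lemma left_lift:
  assumes X: "left_module R X" and f: "f \<in> lin_hom S (restrict_scalars \<theta> X) P"
  shows "\<exists>g\<in>lin_hom R X W. \<forall>x\<in>carrier X. \<tau> (g x) = f x"
proof -
  interpret X: left_module R X by fact
  note fc = lin_hom_closed[OF f, simplified] and fa = lin_hom_add[OF f, simplified]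
    and fs = lin_hom_smult[OF f, simplified]
  let ?o = "\<lambda>x. \<lambda>r\<in>carrier R. f (r \<odot>\<^bsub>X\<^esub> x)"
  have o: "?o x \<in> H" if x: "x \<in> carrier X" for x
  proof -
    have "(\<lambda>r\<in>carrier E. f (r \<odot>\<^bsub>X\<^esub> x)) \<in> H"
      by (rule restrict_lin_hom[OF E_module])
        (use x in \<open>simp_all add: fc fa fs X.smult_closed X.smult_l_distr X.smult_assoc theta_closed\<close>)
    then show ?thesis by simp
  qed
  let ?g = "\<lambda>x\<in>carrier X. \<sigma> (?o x)"
  have "?g \<in> lin_hom R X W"
  proof (rule restrict_lin_hom[OF X])
    fix x y assume xy: "x \<in> carrier X" "y \<in> carrier X"
    have "?o (x \<oplus>\<^bsub>X\<^esub> y) = (\<lambda>r\<in>carrier R. ?o x r \<oplus>\<^bsub>P\<^esub> ?o y r)"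
      using xy by (intro restrict_ext) (simp add: X.smult_r_distr X.smult_closed fa)
    then show "\<sigma> (?o (x \<oplus>\<^bsub>X\<^esub> y)) = \<sigma> (?o x) \<oplus>\<^bsub>W\<^esub> \<sigma> (?o y)"
      by (simp only: sigma_add[OF o[OF xy(1)] o[OF xy(2)]])
  next
    fix a x assume a: "a \<in> carrier R" and x: "x \<in> carrier X"
    have "?o (a \<odot>\<^bsub>X\<^esub> x) = (\<lambda>r\<in>carrier R. ?o x (r \<otimes>\<^bsub>R\<^esub> a))"
      using a x by (intro restrict_ext) (simp add: X.smult_assoc)
    then show "\<sigma> (?o (a \<odot>\<^bsub>X\<^esub> x)) = a \<odot>\<^bsub>W\<^esub> \<sigma> (?o x)"
      by (simp only: sigma_smult[OF o[OF x] a])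
  qed (rule sigma_closed[OF o])
  moreover have "\<tau> (?g x) = f x" if "x \<in> carrier X" for x
    using that by (simp add: \<tau>_def rho_sigma[OF o] X.smult_one)
  ultimately show ?thesis by blast
qed

text \<open>Along \<open>\<sigma>\<close>, a right \<open>S\<close>-linear map \<open>W \<rightarrow> P\<close> is an element of the \<open>P\<close>-valued bidual of \<open>\<^sub>SR\<close>; by
  reflexivity it is evaluation at some \<open>r\<close>, and \<open>\<sigma>\<^sup>-\<^sup>1(w)(r) = \<tau>(r w)\<close>.\<close>

lemma scalar_functional:
  assumes closed: "\<And>w. w \<in> carrier W \<Longrightarrow> \<Lambda> w \<in> carrier P"
    and add: "\<And>w w'. w \<in> carrier W \<Longrightarrow> w' \<in> carrier W \<Longrightarrow> \<Lambda> (w \<oplus>\<^bsub>W\<^esub> w') = \<Lambda> w \<oplus>\<^bsub>P\<^esub> \<Lambda> w'"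
    and rsmult: "\<And>s w. s \<in> carrier S \<Longrightarrow> w \<in> carrier W \<Longrightarrow> \<Lambda> (rsmult W (\<theta> s) w) = rsmult P s (\<Lambda> w)"
  shows "\<exists>r\<in>carrier R. \<forall>w\<in>carrier W. \<Lambda> w = \<tau> (r \<odot>\<^bsub>W\<^esub> w)"
proof -
  have rep: "represents_bidual S P E"
    using P.reflexive_iff_coeff[OF E_module] reflexive by simp
  have "(\<lambda>f\<in>H. \<Lambda> (\<sigma> f)) \<in> coeff_bidual S P E"
    unfolding coeff_bidual_iff
    by (simp add: sigma_add sigma_rsmult sigma_closed H_sum H_rsmult closed add rsmult)
  then obtain r where r: "r \<in> carrier R" and ev: "\<And>f. f \<in> H \<Longrightarrow> \<Lambda> (\<sigma> f) = f r"
    using rep unfolding represents_bidual_def by force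
  have "\<Lambda> w = \<tau> (r \<odot>\<^bsub>W\<^esub> w)" if "w \<in> carrier W" for w
    using ev[OF rho_closed[OF that]] that r by (simp add: sigma_rho rho_tau)
  with r show ?thesis by blast
qed

lemma scalar_functional_unique:
  assumes "r \<in> carrier R" "r' \<in> carrier R"
    and eq: "\<And>w. w \<in> carrier W \<Longrightarrow> \<tau> (r \<odot>\<^bsub>W\<^esub> w) = \<tau> (r' \<odot>\<^bsub>W\<^esub> w)"
  shows "r = r'"
proof -
  have "separated_by S P E"
    using P.reflexive_iff_coeff[OF E_module] reflexive by simp
  moreover have "f r = f r'" if "f \<in> H" for f
    using eq[OF sigma_closed[OF that]] assms(1,2) rho_tau[OF sigma_closed[OF that]]
    by (simp add: rho_sigma[OF that])
  ultimately show ?thesis using assms(1,2) unfolding separated_by_def by simp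
qed

text \<open>For a functional \<open>y\<close> on \<open>W\<close>, the maps \<open>v \<mapsto> w [y,v]\<close> and \<open>v \<mapsto> w' [y,v]\<close> are right endomorphisms,
  hence left multiplications by some \<open>a\<close> and \<open>a'\<close>. Since \<open>\<tau>(a v) = \<tau>(w [y,v]) = \<tau>(w' [y,v]) = \<tau>(a' v)\<close>
  for all \<open>v\<close>, these agree, so that \<open>w\<close> and \<open>w'\<close> have the same image under all maps of finite rank.\<close>

lemma right_separation:
  assumes w: "w \<in> carrier W" "w' \<in> carrier W"
    and eq: "\<And>r. r \<in> carrier R \<Longrightarrow> \<tau> (rsmult W r w) = \<tau> (rsmult W r w')"
  shows "w = w'"
proof -
  have "e w = e w'" if "e \<in> finite_rank R W W" for e
    using that
  proof induction
    case (rank_one y u)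
    have "\<exists>a\<in>carrier R. \<forall>v\<in>carrier W. rsmult W (W.bracket y v) z = a \<odot>\<^bsub>W\<^esub> v" if z: "z \<in> carrier W" for z
      by (rule W.right_endomorphism)
        (use z in \<open>simp_all add: W.bracket(1)[OF rank_one(1)] W.bracket_add[OF rank_one(1)]
          W.bracket_rsmult[OF rank_one(1)] W.rsmult_closed W.rsmult_l_distr W.rsmult_assoc\<close>)
    then obtain a a' where a: "a \<in> carrier R" "\<And>v. v \<in> carrier W \<Longrightarrow> rsmult W (W.bracket y v) w = a \<odot>\<^bsub>W\<^esub> v"
      and a': "a' \<in> carrier R" "\<And>v. v \<in> carrier W \<Longrightarrow> rsmult W (W.bracket y v) w' = a' \<odot>\<^bsub>W\<^esub> v"
      using w by metis
    have "a = a'"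
      by (rule scalar_functional_unique[OF a(1) a'(1)])
        (simp add: a(2)[symmetric] a'(2)[symmetric] eq W.bracket(1)[OF rank_one(1)])
    then show ?case
      using a(2) a'(2) rank_one w by (simp add: W.bracket(2)[OF rank_one, symmetric])
  qed (use w in simp)
  from this[OF W.identity_finite_rank] show ?thesis using w by simp
qed

text \<open>The map \<open>u \<mapsto> v([y,u])\<close> is right \<open>S\<close>-linear on \<open>W\<close>, hence of the form \<open>u \<mapsto> \<tau>(b u)\<close>. Consequently
  \<open>v([y,u] r) = \<tau>(b u r)\<close>, which represents \<open>v([y,u] -)\<close> by the element \<open>b u\<close>. The unit of \<open>R\<close> is a sum of
  brackets because right multiplication by it, the identity of \<open>W\<close>, has finite rank.\<close>

lemma right_lift:
  assumes closed: "\<And>r. r \<in> carrier R \<Longrightarrow> v r \<in> carrier P"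
    and add: "\<And>r r'. r \<in> carrier R \<Longrightarrow> r' \<in> carrier R \<Longrightarrow> v (r \<oplus>\<^bsub>R\<^esub> r') = v r \<oplus>\<^bsub>P\<^esub> v r'"
    and rsmult: "\<And>s r. s \<in> carrier S \<Longrightarrow> r \<in> carrier R \<Longrightarrow> v (r \<otimes>\<^bsub>R\<^esub> \<theta> s) = rsmult P s (v r)"
  shows "\<exists>w\<in>carrier W. \<forall>r\<in>carrier R. v r = \<tau> (rsmult W r w)"
proof -
  \<comment> \<open>The scalar \<open>a\<close> that induces the map \<open>e\<close> of finite rank is a sum of brackets.\<close>
  have "\<exists>w\<in>carrier W. \<forall>r\<in>carrier R. v (a \<otimes>\<^bsub>R\<^esub> r) = \<tau> (rsmult W r w)"
    if "e \<in> finite_rank R W W" "a \<in> carrier R" "\<And>z. z \<in> carrier W \<Longrightarrow> e z = rsmult W a z" for e a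
    using that
  proof (induction arbitrary: a)
    case (rank_one y u)
    note y = rank_one(1) and u = rank_one(2)
    have a: "W.bracket y u = a"
      by (rule W.bracket_eqI[OF y u rank_one(3)]) (simp add: rank_one(4)[symmetric])
    have "\<exists>b\<in>carrier R. \<forall>w\<in>carrier W. v (W.bracket y w) = \<tau> (b \<odot>\<^bsub>W\<^esub> w)"
      by (rule scalar_functional)
        (simp_all add: W.bracket(1)[OF y] W.bracket_add[OF y] W.bracket_rsmult[OF y] theta_closed
          closed add rsmult)
    then obtain b where b: "b \<in> carrier R" "\<And>w. w \<in> carrier W \<Longrightarrow> v (W.bracket y w) = \<tau> (b \<odot>\<^bsub>W\<^esub> w)" by blast
    have "v (a \<otimes>\<^bsub>R\<^esub> r) = \<tau> (rsmult W r (b \<odot>\<^bsub>W\<^esub> u))" if r: "r \<in> carrier R" for r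
      using b(2)[OF W.rsmult_closed[OF r u]] b(1) r u
      by (simp add: W.bracket_rsmult[OF y] a W.rsmult_smult)
    then show ?case using W.smult_closed[OF b(1) u] by blast
  next
    case (rank_sum e e')
    have "e \<in> lin_hom R W W" "e' \<in> lin_hom R W W"
      using rank_sum(1,2) by (auto intro: W.finite_rank_lin_hom)
    then obtain c c' where c: "c \<in> carrier R" "\<And>z. z \<in> carrier W \<Longrightarrow> e z = rsmult W c z"
      and c': "c' \<in> carrier R" "\<And>z. z \<in> carrier W \<Longrightarrow> e' z = rsmult W c' z"
      using W.endomorphism_scalar by metis
    obtain w w' where w: "w \<in> carrier W" "\<And>r. r \<in> carrier R \<Longrightarrow> v (c \<otimes>\<^bsub>R\<^esub> r) = \<tau> (rsmult W r w)"
      and w': "w' \<in> carrier W" "\<And>r. r \<in> carrier R \<Longrightarrow> v (c' \<otimes>\<^bsub>R\<^esub> r) = \<tau> (rsmult W r w')"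
      using rank_sum(3)[OF c] rank_sum(4)[OF c'] by blast
    have "(\<lambda>x\<in>carrier W. e x \<oplus>\<^bsub>W\<^esub> e' x) \<in> lin_hom R W W"
      by (rule lin_hom_sum[OF W.left_module_axioms W.left_module_axioms]) fact+
    from W.endomorphism_scalar[OF this] have "a = c \<oplus>\<^bsub>R\<^esub> c'"
      using rank_sum(5,6) c c' by (auto simp: W.rsmult_l_distr)
    then have "v (a \<otimes>\<^bsub>R\<^esub> r) = \<tau> (rsmult W r (w \<oplus>\<^bsub>W\<^esub> w'))" if "r \<in> carrier R" for r
      using that c(1) c'(1) w w'
      by (simp add: W.R.l_distr add W.rsmult_r_distr tau_add W.rsmult_closed)
    then show ?case using w(1) w'(1) by blast
  qed
  from this[OF W.identity_finite_rank W.R.one_closed] show ?thesis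
    by (auto simp: W.rsmult_one)
qed

text \<open>That \<open>g(x)\<close> and \<open>g(y)\<close> agree is tested on all \<open>\<tau>(g(x) r)\<close>, and \<open>\<tau>(g(-) r)\<close> is itself an \<open>S\<close>-linear
  map into \<open>P\<close>.\<close>

lemma separated_by_restrict:
  assumes X: "left_module R X"
  shows "separated_by R W X \<longleftrightarrow> separated_by S P (restrict_scalars \<theta> X)"
proof -
  have "(\<forall>g\<in>lin_hom R X W. g x = g y) \<longleftrightarrow> (\<forall>f\<in>lin_hom S (restrict_scalars \<theta> X) P. f x = f y)"
    if xy: "x \<in> carrier X" "y \<in> carrier X" for x y
  proof (intro iffI ballI)
    fix f assume "f \<in> lin_hom S (restrict_scalars \<theta> X) P" and eq: "\<forall>g\<in>lin_hom R X W. g x = g y"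
    then obtain g where "g \<in> lin_hom R X W" "\<forall>x\<in>carrier X. \<tau> (g x) = f x"
      using left_lift[OF X] by blast
    then show "f x = f y" using eq xy by metis
  next
    fix g assume g: "g \<in> lin_hom R X W" and eq: "\<forall>f\<in>lin_hom S (restrict_scalars \<theta> X) P. f x = f y"
    show "g x = g y"
    proof (rule right_separation)
      fix r assume "r \<in> carrier R"
      from bspec[OF eq tau_compose[OF X W.lin_hom_rsmult[OF X g this]]]
      show "\<tau> (rsmult W r (g x)) = \<tau> (rsmult W r (g y))" using xy by simp
    qed (use lin_hom_closed[OF g] xy in auto)
  qed
  then show ?thesis by (simp add: separated_by_def)
qed

text \<open>From a functional \<open>\<Phi>\<close> on \<open>Hom\<^sub>S(X,P)\<close>, the element \<open>\<Psi>(g)\<close> of \<open>W\<close> is obtained by applying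
  \<open>right_lift\<close> to \<open>r \<mapsto> \<Phi>(\<tau> \<circ> (g r))\<close>; uniqueness makes \<open>\<Psi>\<close> right \<open>R\<close>-linear.\<close>

lemma represents_bidual_restrictI:
  assumes X: "left_module R X" and rep: "represents_bidual R W X"
  shows "represents_bidual S P (restrict_scalars \<theta> X)"
  unfolding represents_bidual_def restrict_scalars_simps
proof
  let ?G = "lin_hom R X W" and ?F = "lin_hom S (restrict_scalars \<theta> X) P"
  fix \<Phi> assume "\<Phi> \<in> coeff_bidual S P (restrict_scalars \<theta> X)"
  then have \<Phi>: "\<And>f. f \<in> ?F \<Longrightarrow> \<Phi> f \<in> carrier P"
    and \<Phi>_add: "\<And>f g. f \<in> ?F \<Longrightarrow> g \<in> ?F \<Longrightarrow> \<Phi> (\<lambda>x\<in>carrier X. f x \<oplus>\<^bsub>P\<^esub> g x) = \<Phi> f \<oplus>\<^bsub>P\<^esub> \<Phi> g"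
    and \<Phi>_rsmult: "\<And>f s. f \<in> ?F \<Longrightarrow> s \<in> carrier S \<Longrightarrow>
      \<Phi> (\<lambda>x\<in>carrier X. rsmult P s (f x)) = rsmult P s (\<Phi> f)"
    by (auto simp: coeff_bidual_iff)
  let ?t = "\<lambda>g. \<lambda>x\<in>carrier X. \<tau> (g x)"
  let ?s = "\<lambda>r g. \<lambda>x\<in>carrier X. rsmult W r (g x)"
  note t = tau_compose[OF X] and s = W.lin_hom_rsmult[OF X]
  have ex: "\<exists>w. w \<in> carrier W \<and> (\<forall>r\<in>carrier R. \<Phi> (?t (?s r g)) = \<tau> (rsmult W r w))" if g: "g \<in> ?G" for g
  proof -
    note gc = lin_hom_closed[OF g]
    have "\<exists>w\<in>carrier W. \<forall>r\<in>carrier R. \<Phi> (?t (?s r g)) = \<tau> (rsmult W r w)"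
    proof (rule right_lift)
      fix r assume "r \<in> carrier R"
      then show "\<Phi> (?t (?s r g)) \<in> carrier P" by (intro \<Phi> t s g)
    next
      fix r r' assume r: "r \<in> carrier R" "r' \<in> carrier R"
      have "?t (?s (r \<oplus>\<^bsub>R\<^esub> r') g) = (\<lambda>x\<in>carrier X. ?t (?s r g) x \<oplus>\<^bsub>P\<^esub> ?t (?s r' g) x)"
        using gc r by (intro restrict_ext) (simp add: W.rsmult_l_distr tau_add W.rsmult_closed)
      then show "\<Phi> (?t (?s (r \<oplus>\<^bsub>R\<^esub> r') g)) = \<Phi> (?t (?s r g)) \<oplus>\<^bsub>P\<^esub> \<Phi> (?t (?s r' g))"
        by (simp only: \<Phi>_add[OF t[OF s[OF g r(1)]] t[OF s[OF g r(2)]]])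
    next
      fix a r assume a: "a \<in> carrier S" and r: "r \<in> carrier R"
      have "?t (?s (r \<otimes>\<^bsub>R\<^esub> \<theta> a) g) = (\<lambda>x\<in>carrier X. rsmult P a (?t (?s r g) x))"
        using gc r a by (intro restrict_ext) (simp add: W.rsmult_assoc theta_closed tau_rsmult W.rsmult_closed)
      then show "\<Phi> (?t (?s (r \<otimes>\<^bsub>R\<^esub> \<theta> a) g)) = rsmult P a (\<Phi> (?t (?s r g)))"
        by (simp only: \<Phi>_rsmult[OF t[OF s[OF g r]] a])
    qed
    then show ?thesis by blast
  qed
  define \<Psi> where "\<Psi> = (\<lambda>g\<in>?G. SOME w. w \<in> carrier W \<and>
    (\<forall>r\<in>carrier R. \<Phi> (?t (?s r g)) = \<tau> (rsmult W r w)))"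
  have \<Psi>: "\<Psi> g \<in> carrier W \<and> (\<forall>r\<in>carrier R. \<Phi> (?t (?s r g)) = \<tau> (rsmult W r (\<Psi> g)))"
    if "g \<in> ?G" for g
    unfolding \<Psi>_def restrict_apply'[OF that] by (rule someI_ex[OF ex[OF that]])
  have \<Psi>_closed: "\<Psi> g \<in> carrier W" if "g \<in> ?G" for g
    using \<Psi>[OF that] by blast
  have \<Psi>_eq: "\<tau> (rsmult W r (\<Psi> g)) = \<Phi> (?t (?s r g))" if "g \<in> ?G" "r \<in> carrier R" for g r
    using \<Psi>[OF that(1)] that(2) by simp
  have sum: "(\<lambda>x\<in>carrier X. g x \<oplus>\<^bsub>W\<^esub> h x) \<in> ?G" if "g \<in> ?G" "h \<in> ?G" for g h
    by (rule lin_hom_sum[OF X W.left_module_axioms that])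
  have "\<Psi> \<in> coeff_bidual R W X"
    unfolding coeff_bidual_iff
  proof (intro conjI ballI)
    show "\<Psi> \<in> ?G \<rightarrow>\<^sub>E carrier W"
      using \<Psi>_closed by (auto simp: PiE_def \<Psi>_def)
  next
    fix g h assume gh: "g \<in> ?G" "h \<in> ?G"
    note gc = lin_hom_closed[OF gh(1)] lin_hom_closed[OF gh(2)]
    show "\<Psi> (\<lambda>x\<in>carrier X. g x \<oplus>\<^bsub>W\<^esub> h x) = \<Psi> g \<oplus>\<^bsub>W\<^esub> \<Psi> h"
    proof (rule right_separation)
      fix r assume r: "r \<in> carrier R"
      have eq: "?t (?s r (\<lambda>x\<in>carrier X. g x \<oplus>\<^bsub>W\<^esub> h x)) =
          (\<lambda>x\<in>carrier X. ?t (?s r g) x \<oplus>\<^bsub>P\<^esub> ?t (?s r h) x)"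
        using gc r by (intro restrict_ext) (simp add: W.rsmult_r_distr tau_add W.rsmult_closed)
      show "\<tau> (rsmult W r (\<Psi> (\<lambda>x\<in>carrier X. g x \<oplus>\<^bsub>W\<^esub> h x))) = \<tau> (rsmult W r (\<Psi> g \<oplus>\<^bsub>W\<^esub> \<Psi> h))"
        unfolding \<Psi>_eq[OF sum[OF gh] r] eq \<Phi>_add[OF t[OF s[OF gh(1) r]] t[OF s[OF gh(2) r]]]
          \<Psi>_eq[OF gh(1) r, symmetric] \<Psi>_eq[OF gh(2) r, symmetric]
        using \<Psi>_closed gh r by (simp add: W.rsmult_r_distr tau_add W.rsmult_closed)
    qed (use \<Psi>_closed gh sum in auto)
  next
    fix a g assume a: "a \<in> carrier R" and g: "g \<in> ?G"
    note gc = lin_hom_closed[OF g]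
    show "\<Psi> (?s a g) = rsmult W a (\<Psi> g)"
    proof (rule right_separation)
      fix r assume r: "r \<in> carrier R"
      have eq: "?t (?s r (?s a g)) = ?t (?s (a \<otimes>\<^bsub>R\<^esub> r) g)"
        using gc r a by (intro restrict_ext) (simp add: W.rsmult_assoc)
      show "\<tau> (rsmult W r (\<Psi> (?s a g))) = \<tau> (rsmult W r (rsmult W a (\<Psi> g)))"
        unfolding \<Psi>_eq[OF s[OF g a] r] eq \<Psi>_eq[OF g W.R.m_closed[OF a r], symmetric]
        using \<Psi>_closed[OF g] a r by (simp add: W.rsmult_assoc)
    qed (use \<Psi>_closed[OF g] \<Psi>_closed[OF s[OF g a]] a in \<open>auto simp: W.rsmult_closed\<close>)
  qed
  then obtain x where x: "x \<in> carrier X" and \<Psi>x: "\<And>g. g \<in> ?G \<Longrightarrow> \<Psi> g = g x"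
    using rep unfolding represents_bidual_def by blast
  have "\<Phi> f = f x" if f: "f \<in> ?F" for f
  proof -
    obtain g where g: "g \<in> ?G" and gf: "\<And>x. x \<in> carrier X \<Longrightarrow> \<tau> (g x) = f x"
      using left_lift[OF X f] by blast
    have "?t (?s \<one>\<^bsub>R\<^esub> g) = f"
      using t[OF s[OF g W.R.one_closed]] f
      by (rule lin_hom_eqI) (use lin_hom_closed[OF g] in \<open>simp add: W.rsmult_one gf\<close>)
    then have "\<Phi> f = \<tau> (rsmult W \<one>\<^bsub>R\<^esub> (\<Psi> g))"
      using \<Psi>_eq[OF g W.R.one_closed] by simp
    then show ?thesis
      using x lin_hom_closed[OF g x] by (simp add: \<Psi>x[OF g] W.rsmult_one gf)
  qed
  with x show "\<exists>x\<in>carrier X. \<forall>f\<in>?F. \<Phi> f = f x" by blast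
qed

text \<open>From a functional \<open>\<Psi>\<close> on \<open>Hom\<^sub>R(X,W)\<close>, the functional \<open>\<tau> \<circ> g \<mapsto> \<tau>(\<Psi>(g))\<close> on \<open>Hom\<^sub>S(X,P)\<close> is well
  defined because \<open>g\<close> is determined by \<open>\<tau> \<circ> g\<close>. If it is evaluation at \<open>x\<close>, then \<open>\<tau>(\<Psi>(g) r) = \<tau>(g(x) r)\<close>
  for all \<open>r\<close>, because \<open>g r\<close> is again a map into \<open>W\<close>.\<close>

lemma represents_bidual_extendI:
  assumes X: "left_module R X" and rep: "represents_bidual S P (restrict_scalars \<theta> X)"
  shows "represents_bidual R W X"
  unfolding represents_bidual_def
proof
  interpret X: left_module R X by fact
  let ?G = "lin_hom R X W" and ?F = "lin_hom S (restrict_scalars \<theta> X) P"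
  fix \<Psi> assume "\<Psi> \<in> coeff_bidual R W X"
  then have \<Psi>: "\<And>g. g \<in> ?G \<Longrightarrow> \<Psi> g \<in> carrier W"
    and \<Psi>_add: "\<And>g h. g \<in> ?G \<Longrightarrow> h \<in> ?G \<Longrightarrow> \<Psi> (\<lambda>x\<in>carrier X. g x \<oplus>\<^bsub>W\<^esub> h x) = \<Psi> g \<oplus>\<^bsub>W\<^esub> \<Psi> h"
    and \<Psi>_rsmult: "\<And>g r. g \<in> ?G \<Longrightarrow> r \<in> carrier R \<Longrightarrow>
      \<Psi> (\<lambda>x\<in>carrier X. rsmult W r (g x)) = rsmult W r (\<Psi> g)"
    by (auto simp: coeff_bidual_iff)
  define lift where "lift f = (SOME g. g \<in> ?G \<and> (\<forall>x\<in>carrier X. \<tau> (g x) = f x))" for f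
  have lift: "lift f \<in> ?G" "\<And>x. x \<in> carrier X \<Longrightarrow> \<tau> (lift f x) = f x" if f: "f \<in> ?F" for f
    using someI_ex[of "\<lambda>g. g \<in> ?G \<and> (\<forall>x\<in>carrier X. \<tau> (g x) = f x)"] left_lift[OF X f]
    unfolding lift_def by blast+
  have lift_eqI: "lift f = g" if f: "f \<in> ?F" and g: "g \<in> ?G"
    and eq: "\<And>x. x \<in> carrier X \<Longrightarrow> \<tau> (g x) = f x" for f g
  proof (rule lin_hom_eqI[OF lift(1)[OF f] g], rule left_separation)
    fix x r assume x: "x \<in> carrier X" and r: "r \<in> carrier R"
    then show "\<tau> (r \<odot>\<^bsub>W\<^esub> lift f x) = \<tau> (r \<odot>\<^bsub>W\<^esub> g x)"
      using lin_hom_smult[OF lift(1)[OF f] r x] lin_hom_smult[OF g r x] eq lift(2)[OF f]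
        X.smult_closed[OF r x] by metis
  qed (use lin_hom_closed[OF lift(1)[OF f]] lin_hom_closed[OF g] in auto)
  have sumG: "(\<lambda>x\<in>carrier X. g x \<oplus>\<^bsub>W\<^esub> h x) \<in> ?G" if "g \<in> ?G" "h \<in> ?G" for g h
    by (rule lin_hom_sum[OF X W.left_module_axioms that])
  have sumF: "(\<lambda>x\<in>carrier X. f x \<oplus>\<^bsub>P\<^esub> g x) \<in> ?F" if "f \<in> ?F" "g \<in> ?F" for f g
    using lin_hom_sum[OF restrict_module[OF X] P.left_module_axioms that] by simp
  have scaleF: "(\<lambda>x\<in>carrier X. rsmult P s (f x)) \<in> ?F" if "f \<in> ?F" "s \<in> carrier S" for f s
    using P.lin_hom_rsmult[OF restrict_module[OF X] that] by simp
  note scaleG = W.lin_hom_rsmult[OF X]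
  have "(\<lambda>f\<in>?F. \<tau> (\<Psi> (lift f))) \<in> coeff_bidual S P (restrict_scalars \<theta> X)"
    unfolding coeff_bidual_iff restrict_scalars_simps
  proof (intro conjI ballI)
    show "(\<lambda>f\<in>?F. \<tau> (\<Psi> (lift f))) \<in> ?F \<rightarrow>\<^sub>E carrier P"
      by (simp add: tau_closed \<Psi> lift(1))
  next
    fix f g assume fg: "f \<in> ?F" "g \<in> ?F"
    have "lift (\<lambda>x\<in>carrier X. f x \<oplus>\<^bsub>P\<^esub> g x) = (\<lambda>x\<in>carrier X. lift f x \<oplus>\<^bsub>W\<^esub> lift g x)"
      by (rule lift_eqI[OF sumF[OF fg] sumG[OF lift(1)[OF fg(1)] lift(1)[OF fg(2)]]])
        (use fg in \<open>simp add: tau_add lin_hom_closed[OF lift(1)] lift(2)\<close>)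
    then show "(\<lambda>f\<in>?F. \<tau> (\<Psi> (lift f))) (\<lambda>x\<in>carrier X. f x \<oplus>\<^bsub>P\<^esub> g x) =
        (\<lambda>f\<in>?F. \<tau> (\<Psi> (lift f))) f \<oplus>\<^bsub>P\<^esub> (\<lambda>f\<in>?F. \<tau> (\<Psi> (lift f))) g"
      unfolding restrict_apply'[OF sumF[OF fg]] restrict_apply'[OF fg(1)] restrict_apply'[OF fg(2)]
      using fg by (simp only: \<Psi>_add[OF lift(1) lift(1)] tau_add[OF \<Psi>[OF lift(1)] \<Psi>[OF lift(1)]])
  next
    fix s f assume s: "s \<in> carrier S" and f: "f \<in> ?F"
    have "lift (\<lambda>x\<in>carrier X. rsmult P s (f x)) = (\<lambda>x\<in>carrier X. rsmult W (\<theta> s) (lift f x))"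
      by (rule lift_eqI[OF scaleF[OF f s] scaleG[OF lift(1)[OF f] theta_closed[OF s]]])
        (use s f in \<open>simp add: tau_rsmult lin_hom_closed[OF lift(1)] lift(2)\<close>)
    then show "(\<lambda>f\<in>?F. \<tau> (\<Psi> (lift f))) (\<lambda>x\<in>carrier X. rsmult P s (f x)) =
        rsmult P s ((\<lambda>f\<in>?F. \<tau> (\<Psi> (lift f))) f)"
      unfolding restrict_apply'[OF scaleF[OF f s]] restrict_apply'[OF f]
      using f s by (simp only: \<Psi>_rsmult[OF lift(1) theta_closed] tau_rsmult[OF _ \<Psi>[OF lift(1)]])
  qed
  then obtain x where x: "x \<in> carrier X" and \<Phi>x: "\<And>f. f \<in> ?F \<Longrightarrow> \<tau> (\<Psi> (lift f)) = f x"
    using rep unfolding represents_bidual_def by force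
  have \<tau>\<Psi>: "\<tau> (\<Psi> g) = \<tau> (g x)" if g: "g \<in> ?G" for g
  proof -
    have f: "(\<lambda>x\<in>carrier X. \<tau> (g x)) \<in> ?F" by (rule tau_compose[OF X g])
    have "lift (\<lambda>x\<in>carrier X. \<tau> (g x)) = g"
      by (rule lift_eqI[OF f g]) simp
    then show ?thesis using \<Phi>x[OF f] x by simp
  qed
  have "\<Psi> g = g x" if g: "g \<in> ?G" for g
  proof (rule right_separation)
    fix r assume r: "r \<in> carrier R"
    show "\<tau> (rsmult W r (\<Psi> g)) = \<tau> (rsmult W r (g x))"
      using \<tau>\<Psi>[OF scaleG[OF g r]] x by (simp add: \<Psi>_rsmult[OF g r])
  qed (use \<Psi> g x lin_hom_closed[OF g] in auto)
  with x show "\<exists>x\<in>carrier X. \<forall>g\<in>?G. \<Psi> g = g x" by blast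
qed

end

theorem proposition2p7:
  fixes S :: "('s, 'm) ring_scheme" and R :: "('r, 'n) ring_scheme" and \<theta> :: "'s \<Rightarrow> 'r"
    and P :: "('s, 's, 'p) bimodule" and W :: "('r, 'r, 'w) bimodule" and X :: "('r, 'x) module"
  assumes "ring_hom_ring S R \<theta>"
    and "invertible_bimodule TYPE('k) S P"
    and "invertible_bimodule TYPE('l) R W"
    and "PW_reflexive S R \<theta> P W"
    and "left_module R X"
  shows "(reflexive_module R X \<longleftrightarrow> reflexive_module S (restrict_scalars \<theta> X)) \<and>
         (torsionless_module R X \<longleftrightarrow> torsionless_module S (restrict_scalars \<theta> X))"
proof -
  obtain \<sigma> where \<sigma>: "\<sigma> \<in> bimodule_iso R S (hom_bimodule S (extension_bimodule R \<theta>) P) (restrict_right \<theta> W)"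
    and reflexive: "reflexive_module S (restrict_scalars \<theta> (regular_module R))"
    using assms(4) unfolding PW_reflexive_def by blast
  interpret reflexive_extension S R P W \<theta> \<sigma>
    by (intro reflexive_extension.intro reflexive_extension_axioms.intro)
      (use assms(2,3) in \<open>simp_all add: invertible_progenerator \<sigma> reflexive
        ring_hom_ring.homh[OF assms(1)]\<close>)
  note X = assms(5)
  show ?thesis
    unfolding W.reflexive_iff_coeff[OF X] P.reflexive_iff_coeff[OF restrict_module[OF X]]
      W.torsionless_iff_coeff[OF X] P.torsionless_iff_coeff[OF restrict_module[OF X]]
      separated_by_restrict[OF X]
    using represents_bidual_restrictI[OF X] represents_bidual_extendI[OF X] by blast
qed

end
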